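(* Let $E_n \subseteq \mathbb{T}$ ($n\ge1$) be Lebesgue measurable. The following are equivalent: (a) $\sum_{n \geq 1} m(E_n) < \infty$; (b) $v = \pi \sum_{n \geq 1} \chi_{E_n} \in L^1(\mathbb{T},m)$; (c) $\prod_{n \geq 1} f_{E_n}$ converges absolutely and locally uniformly on $\mathbb{D}$. Moreover, the product in (c) belongs to $\mathsf{R}^{+}$ if and only if $v \in L\log L$.
   Context: $\mathbb{D}$ is the open unit disk, $\mathbb{T}$ the unit circle, $m$ normalized Lebesgue measure, $\chi_E$ the characteristic function of $E$. For measurable $E\subseteq\mathbb{T}$, $f_E(z) = \exp\big[i\pi\int_E \frac{\zeta+z}{\zeta-z}\,dm(\zeta)\big]$, $z\in\mathbb{D}$. A product of functions converges absolutely and locally uniformly if $\sum|1-w_n(z)|$ converges uniformly on compact subsets of $\mathbb{D}$. The Smirnov class is $N^+ = \{f/g : f,g \in H^\infty,\ g \text{ outer}\}$, and $\mathsf{R}^+$ is the set of $f\in N^+$ whose radial boundary values are real a.e.~on $\mathbb{T}$. $L\log L$ is the set of measurable $w$ on $\mathbb{T}$ with $\int_{\mathbb{T}}|w|\log^+|w|\,dm<\infty$. *)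

theory Defs
  imports "HOL-Analysis.Analysis"
begin

text \<open>Normalized Lebesgue measure m on the unit circle T, realised as the
 (completed) push-forward of the uniform probability on [0, 2 pi) under cis.
 It lives on complex numbers and is concentrated on sphere 0 1.\<close>
definition circ_m :: "complex measure" where
  "circ_m = completion (distr (uniform_measure lborel {0..<2*pi}) borel cis)"

definition circ_measurable :: "complex set \<Rightarrow> bool" where
  "circ_measurable E \<longleftrightarrow> E \<in> sets circ_m \<and> E \<subseteq> sphere 0 1"

definition fE :: "complex set \<Rightarrow> complex \<Rightarrow> complex" where
  "fE E z = exp (\<i> * of_real pi * (LINT \<zeta>:E|circ_m. (\<zeta> + z) / (\<zeta> - z)))"

definition prod_abs_loc_unif :: "(nat \<Rightarrow> complex \<Rightarrow> complex) \<Rightarrow> bool" where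
  "prod_abs_loc_unif w \<longleftrightarrow>
     (\<forall>K. compact K \<and> K \<subseteq> ball 0 1 \<longrightarrow>
        uniformly_convergent_on K (\<lambda>N z. \<Sum>n<N. norm (1 - w n z)))"

definition Hinf :: "(complex \<Rightarrow> complex) \<Rightarrow> bool" where
  "Hinf g \<longleftrightarrow> g holomorphic_on ball 0 1 \<and> bounded (g ` ball 0 1)"

text \<open>Outer function: g(z) = c exp(int (zeta+z)/(zeta-z) log w(zeta) dm(zeta)),
 |c| = 1, log w in L^1; here u = log w.\<close>
definition outer :: "(complex \<Rightarrow> complex) \<Rightarrow> bool" where
  "outer g \<longleftrightarrow> (\<exists>c u. norm c = 1 \<and> integrable circ_m u \<and>
     (\<forall>z\<in>ball 0 1. g z = c * exp (LINT \<zeta>|circ_m. ((\<zeta> + z) / (\<zeta> - z)) * of_real (u \<zeta>))))"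

definition smirnov :: "(complex \<Rightarrow> complex) \<Rightarrow> bool" where
  "smirnov F \<longleftrightarrow> (\<exists>g h. Hinf g \<and> Hinf h \<and> outer h \<and>
      (\<forall>z\<in>ball 0 1. F z = g z / h z))"

definition Rplus :: "(complex \<Rightarrow> complex) \<Rightarrow> bool" where
  "Rplus F \<longleftrightarrow> smirnov F \<and>
     (AE \<zeta> in circ_m. \<exists>L::real. ((\<lambda>r::real. F (of_real r * \<zeta>)) \<longlongrightarrow> of_real L) (at_left 1))"

definition LlogL :: "(complex \<Rightarrow> real) \<Rightarrow> bool" where
  "LlogL w \<longleftrightarrow> w \<in> borel_measurable circ_m \<and>
     (\<integral>\<^sup>+ \<zeta>. ennreal (\<bar>w \<zeta>\<bar> * max 0 (ln \<bar>w \<zeta>\<bar>)) \<partial>circ_m) < \<infinity>"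

end

theory Submission
  imports Defs "HOL-Complex_Analysis.Complex_Analysis"
begin

text \<open>
  Write H for the Herglotz integral of v = pi * sum of the indicators of the E n. The product is
  F = exp (i H), and at the origin the n-th factor is exp (i pi m(E n)), which gives the
  equivalence of summability and convergence. Since Re H has radial limits v, with values in
  pi * Z, everything depends on the conjugate function Im H = - log |F|. Put G = 1 + H, which has
  real part at least 1. The mean value property of G Ln G bounds the circle means of |Im H| by
  those of (1 + Re H) log (1 + Re H) and vice versa (Zygmund). If v is in L log L, truncation
  makes the dilations of Im H Cauchy in L^1; hence Im H is the Poisson integral of some w in L^1,
  and exp of minus the Herglotz integral of |w| is a bounded outer denominator for F. Conversely,
  F = g / h with g bounded and h outer bounds Im H below by a Poisson integral; as Im H has mean
  zero, its circle means stay bounded, and Fatou's lemma gives v in L log L.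
\<close>

section \<open>Normalized Lebesgue measure on the circle\<close>

text \<open>For G with positive real part put s = Im G / Re G. Then Re (G Ln G) is Re G ln (Re G)
  minus Re G times K(s), where K(s) = s arctan s - ln (1 + s^2) / 2 is the primitive of arctan. It
  grows like |s|, so the correction is |Im G| up to constant factors and a multiple of Re G. The
  circle means of Re (G Ln G) do not depend on the radius, and this trades |Im H| for Re G ln (Re G)
  in both directions. Adding 1 to H keeps ln (Re G) nonnegative and Ln away from its branch cut. The
  obstacle is that bounded circle means of |Im H| present Im H only as the Poisson integral of a
  measure, whose singular part would spoil an outer denominator. Hence Cauchy convergence in L^1 is
  required: below a truncation level an L^2 identity gives it, above the level Zygmund's inequality
  makes the contribution uniformly small. Once Im H is the Poisson integral of w, its radial limits
  come from the same Fatou theorem as those of Re H, which rests on Vitali's covering lemma and the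
  weak type bound for the maximal function.\<close>

definition circ_b :: "complex measure" where
  "circ_b = distr (uniform_measure lborel {0..<2*pi}) borel cis"

text \<open>Push-forwards, densities and regularity are handled in the Borel measure
  \<open>circ_b\<close>; null sets and arguments by completeness in \<open>circ_m\<close>.\<close>

lemma circ_m_eq: "circ_m = completion circ_b"
  by (simp add: circ_m_def circ_b_def)

lemma sets_circ_b [measurable_cong, simp]: "sets circ_b = sets borel"
  by (simp add: circ_b_def)

lemma space_circ_m [simp]: "space circ_m = UNIV"
  by (simp add: circ_m_def)

lemma measurable_cis [measurable]: "cis \<in> borel_measurable borel"
  by (intro borel_measurable_continuous_onI continuous_intros)

lemma emeasure_circ_b_space: "emeasure circ_b UNIV = 1"
  unfolding circ_b_def
  by (subst emeasure_distr) (auto simp: divide_ennreal)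

lemma emeasure_circ_m_UNIV [simp]: "emeasure circ_m UNIV = 1"
  using emeasure_circ_b_space by (simp add: circ_m_eq)

interpretation circ: finite_measure circ_m
  by (rule finite_measureI) simp

interpretation circ: complete_measure circ_m
  unfolding circ_m_def by (rule completion.complete_measure_axioms)

lemma measure_circ_m_UNIV [simp]: "measure circ_m UNIV = 1"
  by (simp add: measure_def)

section \<open>Measurability and integrability on the circle\<close>

lemma borel_measurable_circ_m: "f \<in> borel_measurable borel \<Longrightarrow> f \<in> borel_measurable circ_m"
  unfolding circ_m_eq by (rule measurable_completion) simp

lemma borel_sets_circ_m: "A \<in> sets borel \<Longrightarrow> A \<in> sets circ_m"
  by (simp add: circ_m_eq)

lemma AE_circ_m_sphere: "AE \<zeta> in circ_m. norm \<zeta> = 1"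
proof -
  have "AE \<zeta> in circ_b. norm \<zeta> = 1"
    unfolding circ_b_def by (subst AE_distr_iff) auto
  then show ?thesis
    unfolding circ_m_eq by (rule AE_completion)
qed

text \<open>This rests on completeness. A function then only has to behave well on the circle, so
  kernels with a pole inside the disk can be integrated without a cut-off.\<close>

lemma borel_measurable_circ_m_AE:
  assumes g: "g \<in> measurable circ_m N" and ae: "AE \<zeta> in circ_m. f \<zeta> = g \<zeta>"
    and "\<And>x. f x \<in> space N"
  shows "f \<in> measurable circ_m N"
proof (rule measurableI)
  fix A assume A: "A \<in> sets N"
  show "f -` A \<inter> space circ_m \<in> sets circ_m"
  proof (rule circ.in_sets_AE)
    show "g -` A \<inter> space circ_m \<in> sets circ_m"
      using g A by (rule measurable_sets)
    show "AE x in circ_m. (x \<in> g -` A \<inter> space circ_m) = (x \<in> f -` A \<inter> space circ_m)"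
      using ae by eventually_elim auto
  qed auto
qed (use assms in auto)

lemma borel_measurable_circ_m_continuous:
  fixes f :: "complex \<Rightarrow> 'a::real_normed_vector"
  assumes "continuous_on (sphere 0 1) f"
  shows "f \<in> borel_measurable circ_m"
proof -
  have "(\<lambda>x. indicator (sphere 0 1) x *\<^sub>R f x) \<in> borel_measurable borel"
    using assms by (intro borel_measurable_continuous_on_indicator) auto
  then have g: "(\<lambda>x. indicator (sphere 0 1) x *\<^sub>R f x) \<in> borel_measurable circ_m"
    by (rule borel_measurable_circ_m)
  show ?thesis
    by (rule borel_measurable_circ_m_AE[OF g]) (use AE_circ_m_sphere in \<open>auto elim: eventually_mono\<close>)
qed

lemma integrable_circ_m_continuous:
  fixes f :: "complex \<Rightarrow> 'a::{banach, second_countable_topology}"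
  assumes "continuous_on (sphere 0 1) f"
  shows "integrable circ_m f"
proof -
  have "bounded (f ` sphere 0 1)"
    using assms by (intro compact_imp_bounded compact_continuous_image) auto
  then obtain B where "\<And>x. norm x = 1 \<Longrightarrow> norm (f x) \<le> B"
    unfolding bounded_iff by (metis imageI mem_sphere_0)
  then have "AE x in circ_m. norm (f x) \<le> B"
    using AE_circ_m_sphere by (auto elim: eventually_mono)
  then show ?thesis
    using assms by (intro circ.integrable_const_bound borel_measurable_circ_m_continuous)
qed

text \<open>On the circle d zeta = i zeta dt while dm = dt / (2 pi); the factor zeta in the
  integrand and the divisor 2 pi i convert one into the other.\<close>

lemma integral_circ_m_eq_circlepath:
  fixes f :: "complex \<Rightarrow> complex"
  assumes cont: "continuous_on (sphere 0 1) f"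
    and int: "(f has_contour_integral I) (circlepath 0 1)"
  shows "(LINT \<zeta>|circ_m. f \<zeta> * \<zeta>) = I / (2 * of_real pi * \<i>)"
proof -
  \<comment> \<open>Cut off outside the circle, the integrand is Borel on the whole plane, as the
    rules for completion and push-forward require.\<close>
  define g where "g = (\<lambda>\<zeta>. indicator (sphere 0 1) \<zeta> *\<^sub>R (f \<zeta> * \<zeta>))"
  have cg: "continuous_on (sphere 0 1) (\<lambda>\<zeta>. f \<zeta> * \<zeta>)"
    using cont by (intro continuous_intros)
  have g[measurable]: "g \<in> borel_measurable borel"
    unfolding g_def using cg by (intro borel_measurable_continuous_on_indicator) auto
  have "(LINT \<zeta>|circ_m. f \<zeta> * \<zeta>) = (LINT \<zeta>|circ_m. g \<zeta>)"
    using AE_circ_m_sphere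
    by (intro integral_cong_AE borel_measurable_circ_m_continuous[OF cg] borel_measurable_circ_m g)
       (auto simp: g_def elim: eventually_mono)
  also have "\<dots> = (LINT \<zeta>|circ_b. g \<zeta>)"
    unfolding circ_m_eq by (rule integral_completion) simp
  also have "\<dots> = (LINT t|uniform_measure lborel {0..<2*pi}. g (cis t))"
    unfolding circ_b_def by (rule integral_distr) auto
  also have "\<dots> = (LINT t|density lborel (\<lambda>t. ennreal (indicator {0..<2*pi} t / (2*pi))). g (cis t))"
    by (intro arg_cong2[where f="integral\<^sup>L"])
       (auto simp: uniform_measure_def divide_ennreal[symmetric] ennreal_indicator intro!: density_cong)
  also have "\<dots> = (LINT t|lborel. (indicator {0..<2*pi} t / (2*pi)) *\<^sub>R g (cis t))"
    by (rule integral_density) (auto simp: divide_nonneg_pos)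
  \<comment> \<open>The measure lives on [0, 2 pi) and the contour integral on [0, 2 pi]; the
    endpoint is a null set.\<close>
  also have "\<dots> = (LINT t|lborel. (1 / (2*pi)) *\<^sub>R (indicator {0..2*pi} t *\<^sub>R (f (cis t) * cis t)))"
  proof (rule integral_cong_AE)
    have "f \<circ> cis \<in> borel_measurable borel"
      by (intro borel_measurable_continuous_onI continuous_on_compose continuous_intros
                continuous_on_subset[OF cont]) auto
    then have [measurable]: "(\<lambda>t. f (cis t)) \<in> borel_measurable borel"
      by (simp add: o_def)
    show "(\<lambda>t. (1 / (2*pi)) *\<^sub>R (indicator {0..2*pi} t *\<^sub>R (f (cis t) * cis t))) \<in> borel_measurable lborel"
      by measurable
    show "AE t in lborel. (indicator {0..<2*pi} t / (2*pi)) *\<^sub>R g (cis t)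
         = (1 / (2*pi)) *\<^sub>R (indicator {0..2*pi} t *\<^sub>R (f (cis t) * cis t))"
      using AE_lborel_singleton[of "2*pi"]
      by eventually_elim (auto simp: g_def indicator_def)
  qed auto
  also have "\<dots> = (1 / (2*pi)) *\<^sub>R (LINT t:{0..2*pi}|lborel. f (cis t) * cis t)"
    unfolding set_lebesgue_integral_def by (rule integral_scaleR_right)
  also have "(LINT t:{0..2*pi}|lborel. f (cis t) * cis t) = integral {0..2*pi} (\<lambda>t. f (cis t) * cis t)"
  proof (rule set_borel_integral_eq_integral)
    have "continuous_on {0..2*pi} (\<lambda>t. f (cis t) * cis t)"
      by (intro continuous_intros continuous_on_compose2[OF cont]) auto
    then show "set_integrable lborel {0..2*pi} (\<lambda>t. f (cis t) * cis t)"
      by (rule borel_integrable_atLeastAtMost')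
  qed
  also have "\<dots> = I / \<i>"
  proof -
    have "((\<lambda>t. f (cis t) * \<i> * cis t) has_integral I) {0..2*pi}"
      using int has_contour_integral_part_circlepath_iff[of 0 "2*pi" f I 0 1]
      by (simp add: circlepath_def)
    then have "((\<lambda>t. f (cis t) * \<i> * cis t * (1/\<i>)) has_integral I * (1/\<i>)) {0..2*pi}"
      by (rule has_integral_mult_left)
    then show ?thesis
      by (intro integral_unique) (simp add: field_simps)
  qed
  finally show ?thesis
    by (simp add: scaleR_conv_of_real field_simps)
qed

lemma circ_m_Cauchy_formula:
  assumes "continuous_on (cball 0 1) f" "f holomorphic_on ball 0 1" "norm w < 1"
  shows "(LINT \<zeta>|circ_m. f \<zeta> / (\<zeta> - w) * \<zeta>) = f w"
proof (subst integral_circ_m_eq_circlepath)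
  show "((\<lambda>\<zeta>. f \<zeta> / (\<zeta> - w)) has_contour_integral 2 * of_real pi * \<i> * f w) (circlepath 0 1)"
    using assms by (intro Cauchy_integral_circlepath) auto
  show "continuous_on (sphere 0 1) (\<lambda>\<zeta>. f \<zeta> / (\<zeta> - w))"
    using assms(3) by (intro continuous_intros continuous_on_subset[OF assms(1)]) auto
qed auto

lemma circ_m_mean_value:
  assumes "continuous_on (cball 0 1) f" "f holomorphic_on ball 0 1"
  shows "(LINT \<zeta>|circ_m. f \<zeta>) = f 0"
proof -
  have "(LINT \<zeta>|circ_m. f \<zeta>) = (LINT \<zeta>|circ_m. f \<zeta> / (\<zeta> - 0) * \<zeta>)"
  proof (rule integral_cong_AE)
    show "AE \<zeta> in circ_m. f \<zeta> = f \<zeta> / (\<zeta> - 0) * \<zeta>"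
      using AE_circ_m_sphere by eventually_elim auto
  qed (intro borel_measurable_circ_m_continuous continuous_intros continuous_on_subset[OF assms(1)]; auto)+
  also have "\<dots> = f 0"
    by (rule circ_m_Cauchy_formula[OF assms]) simp
  finally show ?thesis .
qed

section \<open>Herglotz and Poisson integrals\<close>

text \<open>The Herglotz kernel. For zeta on the circle its real part is the Poisson kernel, see
  \<open>pois_eq\<close>.\<close>

definition hk :: "complex \<Rightarrow> complex \<Rightarrow> complex" where
  "hk z \<zeta> = (\<zeta> + z) / (\<zeta> - z)"

definition herg :: "(complex \<Rightarrow> real) \<Rightarrow> complex \<Rightarrow> complex" where
  "herg f z = (LINT \<zeta>|circ_m. hk z \<zeta> * of_real (f \<zeta>))"

definition pois :: "complex \<Rightarrow> complex \<Rightarrow> real" where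
  "pois z \<zeta> = Re (hk z \<zeta>)"

lemma herglotz_kernel_eq:
  fixes \<zeta> z :: complex
  assumes "\<zeta> \<noteq> z" shows "hk z \<zeta> = 2 * \<zeta> / (\<zeta> - z) - 1"
  using assms by (simp add: hk_def field_simps)

lemma pois_eq:
  assumes "norm \<zeta> = 1"
  shows "pois z \<zeta> = (1 - (norm z)\<^sup>2) / (norm (\<zeta> - z))\<^sup>2"
proof -
  have "pois z \<zeta> = Re ((\<zeta> + z) * cnj (\<zeta> - z)) / (norm (\<zeta> - z))\<^sup>2"
    unfolding pois_def hk_def complex_div_cnj[of "\<zeta> + z"] by (simp flip: of_real_power)
  also have "Re ((\<zeta> + z) * cnj (\<zeta> - z)) = (norm \<zeta>)\<^sup>2 - (norm z)\<^sup>2"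
    unfolding cmod_power2 by (simp add: algebra_simps power2_eq_square)
  finally show ?thesis
    using assms by simp
qed

lemma pois_pos: "norm \<zeta> = 1 \<Longrightarrow> norm z < 1 \<Longrightarrow> 0 < pois z \<zeta>"
  by (subst pois_eq) (auto intro!: divide_pos_pos simp: power_less_one_iff abs_square_less_1)

lemma norm_herglotz_kernel_le:
  fixes \<zeta> z :: complex
  assumes "norm \<zeta> = 1" "norm z < 1"
  shows "norm (hk z \<zeta>) \<le> 2 / (1 - norm z)"
proof -
  have "1 - norm z \<le> norm (\<zeta> - z)" "norm (\<zeta> + z) \<le> 2"
    using norm_triangle_ineq2[of \<zeta> z] norm_triangle_ineq[of \<zeta> z] assms by auto
  then show ?thesis
    unfolding hk_def norm_divide using assms by (intro frac_le) auto
qed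

lemma herglotz_kernel_measurable:
  "norm z < 1 \<Longrightarrow> (\<lambda>\<zeta>. hk z \<zeta>) \<in> borel_measurable circ_m"
  unfolding hk_def by (intro borel_measurable_circ_m_continuous continuous_intros) auto

lemma herg_integrable:
  assumes f: "integrable circ_m f" and z: "norm z < 1"
  shows "integrable circ_m (\<lambda>\<zeta>. hk z \<zeta> * of_real (f \<zeta>))"
proof (rule Bochner_Integration.integrable_bound)
  show "integrable circ_m (\<lambda>\<zeta>. 2 / (1 - norm z) * f \<zeta>)"
    using f by (rule integrable_mult_right)
  have [measurable]: "f \<in> borel_measurable circ_m"
    using f by simp
  note [measurable] = herglotz_kernel_measurable[OF z]
  show "(\<lambda>\<zeta>. hk z \<zeta> * of_real (f \<zeta>)) \<in> borel_measurable circ_m"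
    by measurable
  show "AE \<zeta> in circ_m. norm (hk z \<zeta> * of_real (f \<zeta>)) \<le> norm (2 / (1 - norm z) * f \<zeta>)"
    using AE_circ_m_sphere
  proof eventually_elim
    case (elim \<zeta>)
    then show ?case
      using norm_herglotz_kernel_le[of \<zeta> z] z
      unfolding norm_mult by (auto intro!: mult_right_mono simp del: times_divide_eq_left)
  qed
qed

lemma herg_add:
  assumes "integrable circ_m f" "integrable circ_m g" "norm z < 1"
  shows "herg (\<lambda>\<zeta>. f \<zeta> + g \<zeta>) z = herg f z + herg g z"
  unfolding herg_def of_real_add distrib_left
  using herg_integrable[OF assms(1,3)] herg_integrable[OF assms(2,3)]
  by (rule Bochner_Integration.integral_add)

lemma herg_cmult: "herg (\<lambda>\<zeta>. c * f \<zeta>) z = of_real c * herg f z"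
  unfolding herg_def of_real_mult mult.left_commute[of _ "complex_of_real c"] by (rule integral_mult_right_zero)

lemma herg_minus: "herg (\<lambda>\<zeta>. - f \<zeta>) z = - herg f z"
  using herg_cmult[of "-1" f z] by simp

lemma herg_diff:
  assumes "integrable circ_m f" "integrable circ_m g" "norm z < 1"
  shows "herg (\<lambda>\<zeta>. f \<zeta> - g \<zeta>) z = herg f z - herg g z"
  using herg_add[of f "\<lambda>\<zeta>. - g \<zeta>" z] assms by (simp add: herg_minus)

lemma herg_cong_AE:
  assumes "AE \<zeta> in circ_m. f \<zeta> = g \<zeta>" "f \<in> borel_measurable circ_m" "g \<in> borel_measurable circ_m" "norm z < 1"
  shows "herg f z = herg g z"
  unfolding herg_def
  by (rule integral_cong_AE)
     (use assms herglotz_kernel_measurable[OF assms(4)] in \<open>auto elim!: eventually_mono\<close>)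

lemma Re_herg:
  assumes "integrable circ_m f" "norm z < 1"
  shows "Re (herg f z) = (LINT \<zeta>|circ_m. pois z \<zeta> * f \<zeta>)"
    and "integrable circ_m (\<lambda>\<zeta>. pois z \<zeta> * f \<zeta>)"
proof -
  note i = herg_integrable[OF assms]
  show "Re (herg f z) = (LINT \<zeta>|circ_m. pois z \<zeta> * f \<zeta>)"
    unfolding herg_def using integral_Re[OF i] by (simp add: pois_def)
  show "integrable circ_m (\<lambda>\<zeta>. pois z \<zeta> * f \<zeta>)"
    using integrable_Re[OF i] by (simp add: pois_def)
qed

lemma Re_herg_mono:
  assumes "integrable circ_m f" "integrable circ_m g" "norm z < 1" "AE \<zeta> in circ_m. f \<zeta> \<le> g \<zeta>"
  shows "Re (herg f z) \<le> Re (herg g z)"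
  unfolding Re_herg(1)[OF assms(1,3)] Re_herg(1)[OF assms(2,3)]
proof (rule integral_mono_AE)
  show "AE \<zeta> in circ_m. pois z \<zeta> * f \<zeta> \<le> pois z \<zeta> * g \<zeta>"
    using AE_circ_m_sphere assms(4)
    by eventually_elim (simp add: mult_left_mono pois_pos[OF _ assms(3)] less_imp_le)
qed (auto intro!: Re_herg assms)

lemma herg_0:
  assumes "integrable circ_m f"
  shows "herg f 0 = of_real (LINT \<zeta>|circ_m. f \<zeta>)"
proof -
  have "AE \<zeta> in circ_m. hk 0 \<zeta> * complex_of_real (f \<zeta>) = complex_of_real (f \<zeta>)"
    using AE_circ_m_sphere by eventually_elim (auto simp: hk_def)
  then have "herg f 0 = (LINT \<zeta>|circ_m. complex_of_real (f \<zeta>))"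
    unfolding herg_def
    using assms herg_integrable[OF assms, of 0] by (intro integral_cong_AE) auto
  then show ?thesis by simp
qed

text \<open>For |zeta| = 1 the kernel plus 1 is twice the geometric series in z / zeta. Integrating
  term by term therefore makes \<open>herg f\<close> plus the mean of f a power series, which is why
  the mean is added first and subtracted at the end.\<close>

lemma herg_holomorphic:
  assumes f: "integrable circ_m f"
  shows "herg f holomorphic_on ball 0 1"
proof -
  define a where "a n = (LINT \<zeta>|circ_m. 2 * (1 / \<zeta>) ^ n * complex_of_real (f \<zeta>))" for n
  have f'[measurable]: "f \<in> borel_measurable circ_m"
    using f by simp
  have "(\<lambda>n. a n * (z - 0) ^ n) sums (herg f z + of_real (LINT \<zeta>|circ_m. f \<zeta>))" if "z \<in> ball 0 1" for z
  proof -
    have z: "norm z < 1" using that by simp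
    define g where "g n \<zeta> = 2 * (z / \<zeta>) ^ n * complex_of_real (f \<zeta>)" for n \<zeta>
    have gi: "integrable circ_m (g n)" for n
    proof (rule Bochner_Integration.integrable_bound)
      show "integrable circ_m (\<lambda>\<zeta>. 2 * f \<zeta>)"
        using f by simp
      have "(\<lambda>\<zeta>. (z / \<zeta>) ^ n) \<in> borel_measurable circ_m"
        by (intro borel_measurable_circ_m_continuous continuous_intros) auto
      then show "g n \<in> borel_measurable circ_m"
        unfolding g_def by measurable
      show "AE \<zeta> in circ_m. norm (g n \<zeta>) \<le> norm (2 * f \<zeta>)"
        using AE_circ_m_sphere
        by eventually_elim (use z in \<open>auto simp: g_def norm_mult norm_power norm_divide abs_mult power_le_one
            intro!: mult_left_le_one_le\<close>)
    qed
    have ng: "AE \<zeta> in circ_m. norm (g n \<zeta>) = 2 * norm z ^ n * \<bar>f \<zeta>\<bar>" for n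
      using AE_circ_m_sphere
      by eventually_elim (auto simp: g_def norm_mult norm_power norm_divide)
    have "(\<lambda>n. LINT \<zeta>|circ_m. g n \<zeta>) sums (LINT \<zeta>|circ_m. (\<Sum>n. g n \<zeta>))"
    proof (rule sums_integral[OF gi])
      show "AE \<zeta> in circ_m. summable (\<lambda>n. norm (g n \<zeta>))"
        using AE_circ_m_sphere
        by eventually_elim (use z in \<open>auto simp: g_def norm_mult norm_power norm_divide
            intro!: summable_mult summable_mult2 summable_geometric\<close>)
      have "(LINT \<zeta>|circ_m. norm (g n \<zeta>)) = (LINT \<zeta>|circ_m. 2 * norm z ^ n * \<bar>f \<zeta>\<bar>)" for n
        using ng[of n] gi[of n] by (intro integral_cong_AE) auto
      then show "summable (\<lambda>n. LINT \<zeta>|circ_m. norm (g n \<zeta>))"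
        using z by (auto intro!: summable_mult summable_mult2 summable_geometric)
    qed
    also have "(\<lambda>n. LINT \<zeta>|circ_m. g n \<zeta>) = (\<lambda>n. a n * (z - 0) ^ n)"
      unfolding a_def g_def integral_mult_left_zero[symmetric]
      by (intro ext Bochner_Integration.integral_cong) (auto simp: power_divide)
    also have "(LINT \<zeta>|circ_m. (\<Sum>n. g n \<zeta>))
        = (LINT \<zeta>|circ_m. hk z \<zeta> * of_real (f \<zeta>) + of_real (f \<zeta>))"
    proof (rule integral_cong_AE)
      show "(\<lambda>\<zeta>. \<Sum>n. g n \<zeta>) \<in> borel_measurable circ_m"
        using gi by (intro borel_measurable_suminf) auto
      show "(\<lambda>\<zeta>. hk z \<zeta> * of_real (f \<zeta>) + of_real (f \<zeta>)) \<in> borel_measurable circ_m"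
        using herg_integrable[OF f z] by (intro borel_measurable_add borel_measurable_integrable integrable_of_real f)
      show "AE \<zeta> in circ_m. (\<Sum>n. g n \<zeta>) = hk z \<zeta> * of_real (f \<zeta>) + of_real (f \<zeta>)"
        using AE_circ_m_sphere
      proof eventually_elim
        case (elim \<zeta>)
        then have "norm (z / \<zeta>) < 1" "\<zeta> \<noteq> z" "\<zeta> \<noteq> 0"
          using z by (auto simp: norm_divide)
        then have "(\<lambda>n. g n \<zeta>) sums (2 * (1 / (1 - z / \<zeta>)) * of_real (f \<zeta>))"
          unfolding g_def by (intro sums_mult sums_mult2 geometric_sums)
        moreover have "1 / (1 - z / \<zeta>) = \<zeta> / (\<zeta> - z)"
          using \<open>\<zeta> \<noteq> z\<close> \<open>\<zeta> \<noteq> 0\<close> by (simp add: field_simps)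
        ultimately have "(\<Sum>n. g n \<zeta>) = 2 * (\<zeta> / (\<zeta> - z)) * of_real (f \<zeta>)"
          by (simp add: sums_iff)
        then show ?case
          using \<open>\<zeta> \<noteq> z\<close> by (simp add: herglotz_kernel_eq algebra_simps)
      qed
    qed
    also have "\<dots> = herg f z + of_real (LINT \<zeta>|circ_m. f \<zeta>)"
      unfolding herg_def using herg_integrable[OF f z] f by simp
    finally show ?thesis .
  qed
  then have "(\<lambda>z. herg f z + of_real (LINT \<zeta>|circ_m. f \<zeta>)) holomorphic_on ball 0 1"
    by (rule power_series_holomorphic)
  then have "(\<lambda>z. (herg f z + of_real (LINT \<zeta>|circ_m. f \<zeta>)) - of_real (LINT \<zeta>|circ_m. f \<zeta>)) holomorphic_on ball 0 1"
    by (rule holomorphic_on_diff) (rule holomorphic_on_const)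
  then show ?thesis by simp
qed

section \<open>Dilations to smaller circles and the Poisson formula\<close>

lemma holomorphic_dilation:
  assumes "g holomorphic_on ball 0 1" "\<bar>r\<bar> < 1"
  shows "(\<lambda>\<zeta>. g (of_real r * \<zeta>)) holomorphic_on ball 0 1"
    and "continuous_on (cball 0 1) (\<lambda>\<zeta>. g (of_real r * \<zeta>))"
proof -
  have *: "norm (complex_of_real r * \<zeta>) < 1" if "norm \<zeta> \<le> 1" for \<zeta>
    using that assms(2) by (simp add: norm_mult) (smt (verit) mult_left_le_one_le mult_right_le_one_le norm_ge_zero)
  have "g \<circ> (\<lambda>\<zeta>. of_real r * \<zeta>) holomorphic_on ball 0 1"
    using * by (intro holomorphic_on_compose_gen[OF _ assms(1)] holomorphic_intros) auto
  then show "(\<lambda>\<zeta>. g (of_real r * \<zeta>)) holomorphic_on ball 0 1"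
    by (simp add: o_def)
  show "continuous_on (cball 0 1) (\<lambda>\<zeta>. g (of_real r * \<zeta>))"
    using * by (intro continuous_on_compose2[OF holomorphic_on_imp_continuous_on[OF assms(1)]] continuous_intros) auto
qed

text \<open>A function on the open disk need not have boundary values, so circle means are taken of
  dilations with |r| < 1, which are continuous up to the boundary.\<close>

lemma dilation_mean_value:
  assumes "g holomorphic_on ball 0 1" "\<bar>r\<bar> < 1"
  shows "(LINT \<zeta>|circ_m. g (of_real r * \<zeta>)) = g 0"
  using circ_m_mean_value[OF holomorphic_dilation(2,1)[OF assms]] by simp

lemma dilation_integrable:
  assumes "g holomorphic_on ball 0 1" "\<bar>r\<bar> < 1"
  shows "integrable circ_m (\<lambda>\<zeta>. g (of_real r * \<zeta>))"
  by (intro integrable_circ_m_continuous continuous_on_subset[OF holomorphic_dilation(2)[OF assms]]) auto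

text \<open>On the circle the Poisson kernel is zeta / (zeta - z) + cnj z zeta / (1 - cnj z zeta).
  Against f the first summand gives Cauchy's formula; the second is holomorphic in the disk and
  vanishes at 0, so its mean is 0.\<close>

lemma pois_reproduces:
  assumes "continuous_on (cball 0 1) f" "f holomorphic_on ball 0 1" "norm z < 1"
  shows "(LINT \<zeta>|circ_m. f \<zeta> * of_real (pois z \<zeta>)) = f z"
proof -
  have n1: "1 - cnj z * \<zeta> \<noteq> 0" if "norm \<zeta> \<le> 1" for \<zeta>
  proof
    assume "1 - cnj z * \<zeta> = 0"
    then have "norm (cnj z * \<zeta>) = 1" by (metis eq_iff_diff_eq_0 norm_one)
    then show False using that assms(3)
      by (simp add: norm_mult) (smt (verit) mult_left_le norm_ge_zero)
  qed
  have c1: "continuous_on (sphere 0 1) (\<lambda>\<zeta>. f \<zeta> / (\<zeta> - z) * \<zeta>)"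
    using assms(3) by (intro continuous_intros continuous_on_subset[OF assms(1)]) auto
  have c2: "continuous_on (cball 0 1) (\<lambda>\<zeta>. f \<zeta> * (cnj z * \<zeta> / (1 - cnj z * \<zeta>)))"
    using n1 by (intro continuous_intros assms(1)) auto
  have c3: "continuous_on (sphere 0 1) (\<lambda>\<zeta>. f \<zeta> * of_real (pois z \<zeta>))"
    unfolding pois_def hk_def using assms(3) by (intro continuous_intros continuous_on_subset[OF assms(1)]) auto
  note c2' = continuous_on_subset[OF c2 sphere_cball]
  have "(LINT \<zeta>|circ_m. f \<zeta> * of_real (pois z \<zeta>)) =
    (LINT \<zeta>|circ_m. f \<zeta> / (\<zeta> - z) * \<zeta> + f \<zeta> * (cnj z * \<zeta> / (1 - cnj z * \<zeta>)))"
  proof (rule integral_cong_AE)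
    show "AE \<zeta> in circ_m. f \<zeta> * of_real (pois z \<zeta>) = f \<zeta> / (\<zeta> - z) * \<zeta> + f \<zeta> * (cnj z * \<zeta> / (1 - cnj z * \<zeta>))"
      using AE_circ_m_sphere
    proof eventually_elim
      case (elim \<zeta>)
      have nz: "\<zeta> - z \<noteq> 0" "1 - cnj z * \<zeta> \<noteq> 0"
        using elim assms(3) n1[of \<zeta>] by auto
      have zz: "\<zeta> * cnj \<zeta> = 1"
        using elim by (metis complex_norm_square of_real_1 power_one)
      have "of_real (pois z \<zeta>) = (1 - z * cnj z) / ((\<zeta> - z) * cnj (\<zeta> - z))"
        unfolding pois_eq[OF elim] complex_norm_square[symmetric] by simp
      also have "\<dots> = (1 - z * cnj z) * \<zeta> / ((\<zeta> - z) * (1 - cnj z * \<zeta>))"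
      proof -
        have "cnj (\<zeta> - z) * \<zeta> = 1 - cnj z * \<zeta>" using zz by (simp add: algebra_simps)
        moreover have "\<zeta> \<noteq> 0" using elim by auto
        ultimately show ?thesis
          by (metis (no_types, opaque_lifting) mult.assoc mult_divide_mult_cancel_right)
      qed
      also have "\<dots> = \<zeta> / (\<zeta> - z) + cnj z * \<zeta> / (1 - cnj z * \<zeta>)"
        using nz by (simp add: divide_simps) (simp add: algebra_simps)
      finally have "of_real (pois z \<zeta>) = \<zeta> / (\<zeta> - z) + cnj z * \<zeta> / (1 - cnj z * \<zeta>)" .
      then show ?case by (simp add: distrib_left)
    qed
  qed (intro borel_measurable_circ_m_continuous c1 c2' c3 continuous_on_add)+
  also have "\<dots> = (LINT \<zeta>|circ_m. f \<zeta> / (\<zeta> - z) * \<zeta>) + (LINT \<zeta>|circ_m. f \<zeta> * (cnj z * \<zeta> / (1 - cnj z * \<zeta>)))"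
    by (intro Bochner_Integration.integral_add integrable_circ_m_continuous c1 c2')
  also have "(LINT \<zeta>|circ_m. f \<zeta> / (\<zeta> - z) * \<zeta>) = f z"
    by (rule circ_m_Cauchy_formula[OF assms])
  also have "(LINT \<zeta>|circ_m. f \<zeta> * (cnj z * \<zeta> / (1 - cnj z * \<zeta>))) = f 0 * (cnj z * 0 / (1 - cnj z * 0))"
    using n1 by (intro circ_m_mean_value c2) (auto intro!: holomorphic_intros assms(2))
  finally show ?thesis by simp
qed

lemma integral_pois: "norm z < 1 \<Longrightarrow> (LINT \<zeta>|circ_m. pois z \<zeta>) = 1"
  using pois_reproduces[of "\<lambda>_. 1" z] by (simp add: of_real_eq_1_iff flip: integral_of_real)

lemma pois_continuous: "norm z < 1 \<Longrightarrow> continuous_on (sphere 0 1) (pois z)"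
  unfolding pois_def hk_def by (intro continuous_intros) auto

lemma integrable_pois: "norm z < 1 \<Longrightarrow> integrable circ_m (pois z)"
  by (intro integrable_circ_m_continuous pois_continuous)

section \<open>Radial limits of Poisson integrals\<close>

text \<open>The numerator 1 - (1 - \<rho>)^2 is at least \<rho>, and the distance from \<zeta> to
  the pole is at most \<rho> + \<rho>; the quotient is at least \<rho> / (2 \<rho>)^2.\<close>

lemma pois_lower_bound:
  assumes "norm \<zeta> = 1" "norm z = 1" "0 < \<rho>" "\<rho> \<le> 1" "dist z \<zeta> \<le> \<rho>"
  shows "1 / (4 * \<rho>) \<le> pois (of_real (1 - \<rho>) * z) \<zeta>"
proof -
  let ?w = "of_real (1 - \<rho>) * z"
  have nw: "norm ?w = 1 - \<rho>"
    using assms by (simp add: norm_mult del: of_real_diff)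
  have "norm (\<zeta> - ?w) \<le> norm (\<zeta> - z) + norm (z - ?w)"
    using norm_triangle_ineq[of "\<zeta> - z" "z - ?w"] by simp
  moreover have "z - ?w = of_real \<rho> * z"
    by (simp add: algebra_simps)
  ultimately have le: "norm (\<zeta> - ?w) \<le> 2 * \<rho>"
    using assms by (simp add: norm_mult dist_norm norm_minus_commute)
  have pos: "0 < norm (\<zeta> - ?w)"
    using norm_triangle_ineq2[of \<zeta> ?w] nw assms by linarith
  have "1 / (4 * \<rho>) = \<rho> / (2 * \<rho>)\<^sup>2"
    using assms by (simp add: power2_eq_square)
  also have "\<dots> \<le> (1 - (1 - \<rho>)\<^sup>2) / (2 * \<rho>)\<^sup>2"
    using assms by (intro divide_right_mono) (auto simp: power2_eq_square algebra_simps mult_left_le)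
  also have "\<dots> \<le> (1 - (1 - \<rho>)\<^sup>2) / (norm (\<zeta> - ?w))\<^sup>2"
    using pos assms le by (intro divide_left_mono power_mono) (auto simp: power2_eq_square algebra_simps)
  also have "\<dots> = pois ?w \<zeta>"
    using pois_eq[OF assms(1), of ?w] nw by simp
  finally show ?thesis .
qed

text \<open>The Poisson kernel at the point (1 - \<rho>) z has mean 1 and is at least 1 / (4 \<rho>) on the ball.\<close>

lemma emeasure_circ_ball_le:
  assumes "norm z = 1" "0 < \<rho>"
  shows "emeasure circ_m (ball z \<rho>) \<le> ennreal (4 * \<rho>)"
proof (cases "\<rho> \<le> 1")
  case False
  have "emeasure circ_m (ball z \<rho>) \<le> emeasure circ_m UNIV"
    by (intro emeasure_mono) (auto simp: circ_m_eq)
  also have "\<dots> \<le> ennreal (4 * \<rho>)"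
    using False by (simp add: ennreal_1[symmetric] del: ennreal_1)
  finally show ?thesis .
next
  case True
  let ?w = "of_real (1 - \<rho>) * z"
  have nw: "norm ?w < 1"
    using True assms by (simp add: norm_mult del: of_real_diff)
  have [simp]: "ball z \<rho> \<in> sets circ_m"
    by (auto simp: circ_m_eq)
  have "measure circ_m (ball z \<rho>) / (4 * \<rho>) = (LINT \<zeta>|circ_m. 1 / (4 * \<rho>) * indicator (ball z \<rho>) \<zeta>)"
    by simp
  also have "\<dots> \<le> (LINT \<zeta>|circ_m. pois ?w \<zeta>)"
  proof (rule integral_mono_AE)
    show "AE \<zeta> in circ_m. 1 / (4 * \<rho>) * indicator (ball z \<rho>) \<zeta> \<le> pois ?w \<zeta>"
      using AE_circ_m_sphere
    proof eventually_elim
      case (elim \<zeta>)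
      then show ?case
        using pois_lower_bound[OF elim assms True] pois_pos[OF elim nw]
        by (auto simp: indicator_def simp del: of_real_diff)
    qed
    show "integrable circ_m (\<lambda>\<zeta>. 1 / (4 * \<rho>) * indicator (ball z \<rho>) \<zeta>)"
      by (auto simp: circ.emeasure_finite less_top[symmetric])
  qed (rule integrable_pois[OF nw])
  also have "\<dots> = 1"
    by (rule integral_pois[OF nw])
  finally show ?thesis
    using assms by (auto simp: circ.emeasure_eq_measure field_simps intro!: ennreal_leI)
qed

text \<open>In \<open>pois_eq\<close> the numerator 1 - r^2 is at most 2 (1 - r) and the denominator
  at least d^2 / 4, whence the 8.\<close>

lemma pois_upper_bound:
  assumes "norm \<zeta> = 1" "norm z = 1" "0 \<le> r" "r < 1" "(1 - r) \<le> d" "d / 2 \<le> norm (\<zeta> - of_real r * z)"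
  shows "pois (of_real r * z) \<zeta> \<le> 8 * (1 - r) / d\<^sup>2"
proof -
  have nw: "norm (of_real r * z) = r"
    using assms by (simp add: norm_mult)
  have "0 < d" using assms by simp
  have "pois (of_real r * z) \<zeta> = (1 - r\<^sup>2) / (norm (\<zeta> - of_real r * z))\<^sup>2"
    using pois_eq[OF assms(1), of "of_real r * z"] nw by simp
  also have "\<dots> \<le> (2 * (1 - r)) / (d / 2)\<^sup>2"
  proof (rule frac_le)
    show "1 - r\<^sup>2 \<le> 2 * (1 - r)"
      using zero_le_power2[of "1 - r"] by (simp add: power2_eq_square algebra_simps)
    show "(d / 2)\<^sup>2 \<le> (norm (\<zeta> - of_real r * z))\<^sup>2"
      using assms \<open>0 < d\<close> by (intro power_mono) auto
  qed (use assms \<open>0 < d\<close> in auto)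
  also have "\<dots> = 8 * (1 - r) / d\<^sup>2"
    by (simp add: power_divide)
  finally show ?thesis .
qed

text \<open>For the least k whose ball contains \<zeta>, the kernel is already dominated by the k-th
  term of the series. The weights decay like 4^(-k) while the radii grow like 2^k, which makes the
  bound summable against a maximal function.\<close>

lemma pois_dyadic_bound:
  assumes "norm \<zeta> = 1" "norm z = 1" "0 \<le> r" "r < 1"
  shows "ennreal (pois (of_real r * z) \<zeta>)
    \<le> (\<Sum>k. ennreal (32 / (4 ^ k * (1 - r))) * indicator (cball z (2 ^ k * (1 - r))) \<zeta>)"
proof -
  define \<rho> where "\<rho> = 1 - r"
  have \<rho>: "0 < \<rho>" using assms by (simp add: \<rho>_def)
  obtain k0 where "dist z \<zeta> / \<rho> < 2 ^ k0"
    using real_arch_pow[of 2 "dist z \<zeta> / \<rho>"] by auto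
  then have "dist z \<zeta> \<le> 2 ^ k0 * \<rho>"
    using \<rho> by (simp add: field_simps)
  define k where "k = (LEAST k. dist z \<zeta> \<le> 2 ^ k * \<rho>)"
  have k: "dist z \<zeta> \<le> 2 ^ k * \<rho>"
    unfolding k_def by (rule LeastI) fact
  have nd: "\<rho> \<le> norm (\<zeta> - of_real r * z)"
    using norm_triangle_ineq2[of \<zeta> "of_real r * z"] assms by (simp add: norm_mult \<rho>_def)
  have dz: "dist z \<zeta> \<le> norm (\<zeta> - of_real r * z) + \<rho>"
  proof -
    have "dist z \<zeta> \<le> norm (\<zeta> - of_real r * z) + norm (z - of_real r * z)"
      using norm_triangle_ineq4[of "\<zeta> - of_real r * z" "z - of_real r * z"]
      by (simp add: dist_norm norm_minus_commute)
    moreover have "z - of_real r * z = of_real \<rho> * z"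
      by (simp add: \<rho>_def algebra_simps)
    ultimately show ?thesis
      using assms \<rho> by (simp add: norm_mult)
  qed
  \<comment> \<open>For k > 0 minimality puts \<zeta> farther than 2^(k-1) \<rho> from z, and its
    distance to r z is at least half of that, since this distance is also at least \<rho>.\<close>
  have "2 ^ k * \<rho> / 4 \<le> norm (\<zeta> - of_real r * z)"
  proof (cases k)
    case 0
    then show ?thesis using nd \<rho> by simp
  next
    case (Suc j)
    then have "\<not> dist z \<zeta> \<le> 2 ^ j * \<rho>"
      using not_less_Least[of j "\<lambda>k. dist z \<zeta> \<le> 2 ^ k * \<rho>"] by (simp add: k_def[symmetric])
    then show ?thesis
      using Suc dz nd by (simp add: mult.commute)
  qed
  have "pois (of_real r * z) \<zeta> \<le> 32 / (4 ^ k * \<rho>)"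
  proof (cases k)
    case 0
    have "pois (of_real r * z) \<zeta> \<le> 8 * (1 - r) / \<rho>\<^sup>2"
      using assms nd \<rho> by (intro pois_upper_bound) (auto simp: \<rho>_def)
    also have "\<dots> \<le> 32 / (4 ^ k * \<rho>)"
      using \<rho> 0 by (simp add: \<rho>_def[symmetric] power2_eq_square field_simps)
    finally show ?thesis .
  next
    case (Suc j)
    have "pois (of_real r * z) \<zeta> \<le> 8 * (1 - r) / (2 ^ j * \<rho>)\<^sup>2"
      using assms \<open>2 ^ k * \<rho> / 4 \<le> _\<close> Suc \<rho> by (intro pois_upper_bound) (auto simp: \<rho>_def mult.commute)
    also have "\<dots> = 8 * \<rho> / (4 ^ j * \<rho>\<^sup>2)"
      by (simp add: \<rho>_def power2_eq_square flip: power_mult_distrib)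
    also have "\<dots> = 32 / (4 ^ k * \<rho>)"
      using \<rho> Suc by (simp add: power2_eq_square field_simps)
    finally show ?thesis .
  qed
  define t where "t j = ennreal (32 / (4 ^ j * (1 - r))) * indicator (cball z (2 ^ j * (1 - r))) \<zeta>" for j :: nat
  have "ennreal (pois (of_real r * z) \<zeta>) \<le> t k"
    using k \<open>pois _ _ \<le> _\<close> by (auto simp: \<rho>_def t_def intro!: ennreal_leI)
  also have "\<dots> = sum t {k}"
    by simp
  also have "\<dots> \<le> suminf t"
    by (rule sum_le_suminf) auto
  finally show ?thesis
    by (simp add: t_def[abs_def])
qed

text \<open>Along a radius the Poisson integral is dominated by the Hardy-Littlewood maximal
  function, expressed here by the masses of balls around z. The k-th dyadic term contributes at most
  32 \<epsilon> / 2^k, with sum 64 \<epsilon>.\<close>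

lemma nn_integral_pois_le_maximal:
  assumes f: "f \<in> borel_measurable circ_m" and z: "norm z = 1" "0 \<le> r" "r < 1" and "0 \<le> \<epsilon>"
    and max: "\<And>\<rho>. 0 < \<rho> \<Longrightarrow> emeasure (density circ_m f) (cball z \<rho>) \<le> ennreal (\<epsilon> * \<rho>)"
  shows "(\<integral>\<^sup>+\<zeta>. ennreal (pois (of_real r * z) \<zeta>) * f \<zeta> \<partial>circ_m) \<le> ennreal (64 * \<epsilon>)"
proof -
  have cb[measurable]: "cball z \<rho> \<in> sets circ_m" for \<rho>
    by (auto simp: circ_m_eq)
  note f[measurable]
  have "(\<integral>\<^sup>+\<zeta>. ennreal (pois (of_real r * z) \<zeta>) * f \<zeta> \<partial>circ_m)
    \<le> (\<integral>\<^sup>+\<zeta>. (\<Sum>k. ennreal (32 / (4 ^ k * (1 - r))) * indicator (cball z (2 ^ k * (1 - r))) \<zeta>) * f \<zeta> \<partial>circ_m)"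
    by (intro nn_integral_mono_AE eventually_mono[OF AE_circ_m_sphere] mult_right_mono pois_dyadic_bound z) auto
  also have "\<dots> = (\<integral>\<^sup>+\<zeta>. (\<Sum>k. ennreal (32 / (4 ^ k * (1 - r))) * (f \<zeta> * indicator (cball z (2 ^ k * (1 - r))) \<zeta>)) \<partial>circ_m)"
    by (intro nn_integral_cong) (simp add: ennreal_suminf_multc[symmetric] mult_ac)
  also have "\<dots> = (\<Sum>k. \<integral>\<^sup>+\<zeta>. ennreal (32 / (4 ^ k * (1 - r))) * (f \<zeta> * indicator (cball z (2 ^ k * (1 - r))) \<zeta>) \<partial>circ_m)"
    by (rule nn_integral_suminf) measurable
  also have "\<dots> = (\<Sum>k. ennreal (32 / (4 ^ k * (1 - r))) * emeasure (density circ_m f) (cball z (2 ^ k * (1 - r))))"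
    by (intro suminf_cong) (subst nn_integral_cmult; simp add: emeasure_density)
  also have "\<dots> \<le> (\<Sum>k. ennreal (32 * \<epsilon> * (1 / 2) ^ k))"
  proof (intro suminf_le)
    fix k
    have "ennreal (32 / (4 ^ k * (1 - r))) * emeasure (density circ_m f) (cball z (2 ^ k * (1 - r)))
      \<le> ennreal (32 / (4 ^ k * (1 - r))) * ennreal (\<epsilon> * (2 ^ k * (1 - r)))"
      using z by (intro mult_left_mono max) auto
    also have "\<dots> = ennreal (32 / (4 ^ k * (1 - r)) * (\<epsilon> * (2 ^ k * (1 - r))))"
      using z \<open>0 \<le> \<epsilon>\<close> by (intro ennreal_mult[symmetric]) auto
    also have "32 / (4 ^ k * (1 - r)) * (\<epsilon> * (2 ^ k * (1 - r))) = 32 * \<epsilon> * (2 ^ k / 4 ^ k)"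
      using z by (simp add: field_simps)
    also have "(2::real) ^ k / 4 ^ k = (1 / 2) ^ k"
      by (simp flip: power_divide)
    finally show "ennreal (32 / (4 ^ k * (1 - r))) * emeasure (density circ_m f) (cball z (2 ^ k * (1 - r)))
      \<le> ennreal (32 * \<epsilon> * (1 / 2) ^ k)" .
  qed auto
  also have "\<dots> = ennreal (32 * \<epsilon> * 2)"
  proof (rule suminf_ennreal_eq)
    show "(\<lambda>k. 32 * \<epsilon> * (1 / 2) ^ k) sums (32 * \<epsilon> * 2)"
      using geometric_sums[of "1/2::real"] by (intro sums_mult) auto
  qed (use \<open>0 \<le> \<epsilon>\<close> in auto)
  finally show ?thesis by simp
qed

text \<open>The weak type inequality for the maximal function. Vitali's lemma picks disjoint balls
  of large mass whose fivefold enlargements cover the bad points; B is the union of these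
  enlargements. The 20 is this 5 times the 4 of \<open>emeasure_circ_ball_le\<close>.\<close>

lemma maximal_weak_type:
  assumes f: "integrable circ_m f" "\<And>\<zeta>. 0 \<le> f \<zeta>" and "0 < \<epsilon>"
  obtains B where "B \<in> sets circ_m" "emeasure circ_m B \<le> ennreal (20 / \<epsilon> * (LINT \<zeta>|circ_m. f \<zeta>))"
    "\<And>z \<rho>. norm z = 1 \<Longrightarrow> z \<notin> B \<Longrightarrow> 0 < \<rho> \<Longrightarrow> emeasure (density circ_m f) (cball z \<rho>) \<le> ennreal (\<epsilon> * \<rho>)"
proof -
  define \<mu> where "\<mu> = density circ_m f"
  have [measurable]: "f \<in> borel_measurable circ_m" using f by simp
  have sets[simp]: "sets \<mu> = sets circ_m" by (simp add: \<mu>_def)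
  have cb[simp]: "cball z \<rho> \<in> sets circ_m" "ball z \<rho> \<in> sets circ_m" for z \<rho>
    by (auto simp: circ_m_eq)
  define I where "I = (LINT \<zeta>|circ_m. f \<zeta>)"
  have \<mu>U: "emeasure \<mu> UNIV = ennreal I"
    unfolding \<mu>_def I_def using f nn_integral_eq_integral[of circ_m f] borel_sets_circ_m[of UNIV]
    by (subst emeasure_density) auto
  have \<mu>le: "emeasure \<mu> A \<le> ennreal I" for A
    using emeasure_space[of \<mu> A] \<mu>U by (simp add: \<mu>_def)
  have "0 \<le> I" unfolding I_def using f by simp
  define K where "K = {z. norm z = 1 \<and> (\<exists>\<rho>>0. ennreal (\<epsilon> * \<rho>) < emeasure \<mu> (cball z \<rho>))}"
  define R where "R z = (SOME \<rho>. 0 < \<rho> \<and> ennreal (\<epsilon> * \<rho>) < emeasure \<mu> (cball z \<rho>))" for z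
  have R: "0 < R z" "ennreal (\<epsilon> * R z) < emeasure \<mu> (cball z (R z))" if "z \<in> K" for z
  proof -
    have "\<exists>\<rho>. 0 < \<rho> \<and> ennreal (\<epsilon> * \<rho>) < emeasure \<mu> (cball z \<rho>)"
      using that by (auto simp: K_def)
    from someI_ex[OF this] show "0 < R z" "ennreal (\<epsilon> * R z) < emeasure \<mu> (cball z (R z))"
      by (auto simp: R_def)
  qed
  \<comment> \<open>Vitali's lemma needs bounded radii; here the total mass bounds them.\<close>
  have RB: "0 < R z \<and> R z \<le> I / \<epsilon>" if "z \<in> K" for z
  proof -
    have "ennreal (\<epsilon> * R z) < ennreal I"
      using R(2)[OF that] \<mu>le by (rule less_le_trans)
    then have "\<epsilon> * R z < I"
      using \<open>0 \<le> I\<close> R(1)[OF that] \<open>0 < \<epsilon>\<close> by (simp add: ennreal_less_iff)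
    then show ?thesis
      using R(1)[OF that] \<open>0 < \<epsilon>\<close> by (simp add: field_simps)
  qed
  obtain C where C: "countable C" "C \<subseteq> K"
     "pairwise (\<lambda>i j. disjnt (cball i (R i)) (cball j (R j))) C"
     "\<And>i. i \<in> K \<Longrightarrow> \<exists>j. j \<in> C \<and> \<not> disjnt (cball i (R i)) (cball j (R j)) \<and>
                        cball i (R i) \<subseteq> ball j (5 * R j)"
    using Vitali_covering_lemma_cballs_balls[of K R "I / \<epsilon>" "\<lambda>x. x"] RB by blast
  define S where "S = to_nat_on C ` C"
  define c where "c = from_nat_into C"
  have cS: "c n \<in> C" "to_nat_on C (c n) = n" if "n \<in> S" for n
    using that C(1) by (auto simp: S_def c_def)
  define X where "X n = (if n \<in> S then ball (c n) (5 * R (c n)) else {})" for n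
  define Y where "Y n = (if n \<in> S then cball (c n) (R (c n)) else {})" for n
  have X[simp]: "X n \<in> sets circ_m" and Y[simp]: "Y n \<in> sets circ_m" for n
    by (auto simp: X_def Y_def)
  have disj: "disjoint_family Y"
  proof (unfold disjoint_family_on_def, intro ballI impI)
    fix m n :: nat assume "m \<noteq> n"
    show "Y m \<inter> Y n = {}"
    proof (cases "m \<in> S \<and> n \<in> S")
      case True
      then have "c m \<noteq> c n"
        using cS \<open>m \<noteq> n\<close> by metis
      then show ?thesis
        using C(3) cS True by (auto simp: Y_def pairwise_def disjnt_def)
    qed (auto simp: Y_def)
  qed
  have XY: "emeasure circ_m (X n) \<le> ennreal (20 / \<epsilon>) * emeasure \<mu> (Y n)" for n
  proof (cases "n \<in> S")
    case True
    then have k: "c n \<in> K" using cS C by auto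
    have n1: "norm (c n) = 1" using k by (auto simp: K_def)
    have "emeasure circ_m (X n) \<le> ennreal (4 * (5 * R (c n)))"
      unfolding X_def using emeasure_circ_ball_le[OF n1, of "5 * R (c n)"] R(1)[OF k] True by simp
    also have "\<dots> = ennreal (20 / \<epsilon>) * ennreal (\<epsilon> * R (c n))"
      using \<open>0 < \<epsilon>\<close> R(1)[OF k] by (simp add: ennreal_mult[symmetric])
    also have "\<dots> \<le> ennreal (20 / \<epsilon>) * emeasure \<mu> (Y n)"
      using R(2)[OF k] True by (intro mult_left_mono) (auto simp: Y_def)
    finally show ?thesis .
  qed (auto simp: X_def)
  define B where "B = (\<Union>n. X n)"
  show ?thesis
  proof
    show "B \<in> sets circ_m" unfolding B_def by auto
    have "emeasure circ_m B \<le> (\<Sum>n. emeasure circ_m (X n))"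
      unfolding B_def by (rule emeasure_subadditive_countably) auto
    also have "\<dots> \<le> (\<Sum>n. ennreal (20 / \<epsilon>) * emeasure \<mu> (Y n))"
      by (intro suminf_le XY) auto
    also have "\<dots> = ennreal (20 / \<epsilon>) * emeasure \<mu> (\<Union>n. Y n)"
      using disj by (simp add: suminf_emeasure image_subset_iff)
    also have "\<dots> \<le> ennreal (20 / \<epsilon>) * ennreal I"
      by (intro mult_left_mono \<mu>le) auto
    also have "\<dots> = ennreal (20 / \<epsilon> * I)"
      using \<open>0 < \<epsilon>\<close> \<open>0 \<le> I\<close> by (intro ennreal_mult[symmetric]) auto
    finally show "emeasure circ_m B \<le> ennreal (20 / \<epsilon> * (LINT \<zeta>|circ_m. f \<zeta>))"
      by (simp add: I_def)
    fix z :: complex and \<rho> :: real assume z: "norm z = 1" "z \<notin> B" "0 < \<rho>"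
    have "z \<notin> K"
    proof
      assume "z \<in> K"
      then obtain j where j: "j \<in> C" "cball z (R z) \<subseteq> ball j (5 * R j)"
        using C(4) by blast
      have "to_nat_on C j \<in> S" "c (to_nat_on C j) = j"
        using j C(1) by (auto simp: S_def c_def)
      then have "ball j (5 * R j) = X (to_nat_on C j)"
        by (auto simp: X_def)
      moreover have "z \<in> cball z (R z)"
        using R(1)[OF \<open>z \<in> K\<close>] by simp
      ultimately have "z \<in> X (to_nat_on C j)" using j by blast
      then have "z \<in> B" by (auto simp: B_def)
      with z show False by simp
    qed
    then show "emeasure (density circ_m f) (cball z \<rho>) \<le> ennreal (\<epsilon> * \<rho>)"
      using z by (force simp: K_def \<mu>_def[symmetric] not_less)
  qed
qed

lemma Re_herg_le_maximal:
  assumes f: "integrable circ_m f" "\<And>\<zeta>. 0 \<le> f \<zeta>" and z: "norm z = 1" "0 \<le> r" "r < 1" and "0 \<le> \<epsilon>"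
    and max: "\<And>\<rho>. 0 < \<rho> \<Longrightarrow> emeasure (density circ_m f) (cball z \<rho>) \<le> ennreal (\<epsilon> * \<rho>)"
  shows "Re (herg f (of_real r * z)) \<le> 64 * \<epsilon>"
proof -
  have nz: "norm (of_real r * z) < 1"
    using z by (simp add: norm_mult)
  have "ennreal (Re (herg f (of_real r * z))) = (\<integral>\<^sup>+\<zeta>. ennreal (pois (of_real r * z) \<zeta> * f \<zeta>) \<partial>circ_m)"
    unfolding Re_herg(1)[OF f(1) nz]
  proof (rule nn_integral_eq_integral[symmetric])
    show "AE \<zeta> in circ_m. 0 \<le> pois (of_real r * z) \<zeta> * f \<zeta>"
      using AE_circ_m_sphere by eventually_elim (simp add: f pois_pos nz less_imp_le)
  qed (rule Re_herg(2)[OF f(1) nz])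
  also have "\<dots> = (\<integral>\<^sup>+\<zeta>. ennreal (pois (of_real r * z) \<zeta>) * ennreal (f \<zeta>) \<partial>circ_m)"
  proof (rule nn_integral_cong_AE)
    show "AE \<zeta> in circ_m. ennreal (pois (of_real r * z) \<zeta> * f \<zeta>) = ennreal (pois (of_real r * z) \<zeta>) * ennreal (f \<zeta>)"
      using AE_circ_m_sphere by eventually_elim (simp add: f ennreal_mult pois_pos nz less_imp_le)
  qed
  also have "\<dots> \<le> ennreal (64 * \<epsilon>)"
    using f by (intro nn_integral_pois_le_maximal z max \<open>0 \<le> \<epsilon>\<close>) auto
  finally show ?thesis
    using \<open>0 \<le> \<epsilon>\<close> by (simp add: ennreal_le_iff)
qed

text \<open>As soon as 1 - r < d / 2, every point where f may be nonzero is at distance at least d /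
  2 from r z. There the kernel is at most 8 (1 - r) / d^2, which tends to 0.\<close>

lemma Re_herg_tendsto_0_away:
  assumes f: "integrable circ_m f" "\<And>\<zeta>. 0 \<le> f \<zeta>" and z: "norm z = 1"
    and d: "0 < d" "\<And>\<zeta>. dist z \<zeta> < d \<Longrightarrow> f \<zeta> = 0" and "0 < e"
  shows "eventually (\<lambda>r. Re (herg f (of_real r * z)) < e) (at_left 1)"
proof -
  define I where "I = (LINT \<zeta>|circ_m. f \<zeta>)"
  have "((\<lambda>r::real. 8 * (1 - r) / d\<^sup>2 * I) \<longlongrightarrow> 8 * (1 - 1) / d\<^sup>2 * I) (at_left 1)"
    by (intro tendsto_intros) (use d in auto)
  then have ev: "eventually (\<lambda>r. 8 * (1 - r) / d\<^sup>2 * I < e) (at_left 1)"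
    using \<open>0 < e\<close> by (auto dest!: order_tendstoD(2))
  have "eventually (\<lambda>r. r \<in> {max 0 (1 - d / 2) <..< 1}) (at_left (1::real))"
    using d by (intro eventually_at_left_real) auto
  with ev show ?thesis
  proof eventually_elim
    case (elim r)
    then have r: "0 \<le> r" "r < 1" "1 - r < d / 2" by auto
    have nz: "norm (of_real r * z) < 1"
      using z r by (simp add: norm_mult)
    have "Re (herg f (of_real r * z)) \<le> (LINT \<zeta>|circ_m. 8 * (1 - r) / d\<^sup>2 * f \<zeta>)"
      unfolding Re_herg(1)[OF f(1) nz]
    proof (rule integral_mono_AE)
      show "AE \<zeta> in circ_m. pois (of_real r * z) \<zeta> * f \<zeta> \<le> 8 * (1 - r) / d\<^sup>2 * f \<zeta>"
        using AE_circ_m_sphere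
      proof eventually_elim
        case (elim \<zeta>)
        show ?case
        proof (cases "dist z \<zeta> < d")
          case False
          have "dist z \<zeta> \<le> norm (\<zeta> - of_real r * z) + norm (z - of_real r * z)"
            using norm_triangle_ineq4[of "\<zeta> - of_real r * z" "z - of_real r * z"]
            by (simp add: dist_norm norm_minus_commute)
          moreover have "z - of_real r * z = of_real (1 - r) * z"
            by (simp add: algebra_simps)
          then have "norm (z - of_real r * z) = 1 - r"
            using r z by (simp add: norm_mult del: of_real_diff)
          ultimately have "d / 2 \<le> norm (\<zeta> - of_real r * z)"
            using False r by linarith
          then show ?thesis
            using r d f z elim by (intro mult_right_mono pois_upper_bound) auto
        qed (use d in auto)
      qed
    qed (use Re_herg(2)[OF f(1) nz] f in auto)
    also have "\<dots> = 8 * (1 - r) / d\<^sup>2 * I"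
      by (simp add: I_def)
    finally show ?case using elim by simp
  qed
qed

text \<open>By outer regularity the mass of h near its zero set is carried by an open set U where h has
  small integral. The part of h outside U does not matter at points of U, and the part inside U is
  controlled by the weak type inequality.\<close>

lemma radial_limit_zero_set_borel:
  assumes [measurable]: "h \<in> borel_measurable borel" and h: "integrable circ_m h" "\<And>\<zeta>. 0 \<le> h \<zeta>" and "0 < e"
  shows "AE z in circ_m. h z = 0 \<longrightarrow> eventually (\<lambda>r. Re (herg h (of_real r * z)) < e) (at_left 1)"
proof -
  \<comment> \<open>Then 64 \<epsilon> = e / 2 bounds the part of h inside U, and the part outside
    gets the other half of e.\<close>
  define \<epsilon> where "\<epsilon> = e / 128"
  have \<epsilon>: "0 < \<epsilon>" using \<open>0 < e\<close> by (simp add: \<epsilon>_def)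
  define N where "N = {z. norm z = 1 \<and> h z = 0 \<and> \<not> eventually (\<lambda>r. Re (herg h (of_real r * z)) < e) (at_left 1)}"
  \<comment> \<open>Outer regularity concerns finite Borel measures, so the density is taken with
    respect to \<open>circ_b\<close>.\<close>
  define \<mu> where "\<mu> = density circ_b h"
  have sb: "sets \<mu> = sets borel" by (simp add: \<mu>_def)
  have hb: "integrable circ_b h"
    using h(1) unfolding circ_m_eq by (subst (asm) integrable_completion) auto
  have fin: "emeasure \<mu> (space \<mu>) \<noteq> \<infinity>"
    unfolding \<mu>_def using hb h(2) nn_integral_eq_integral[OF hb] sets.top[of circ_b]
    by (subst emeasure_density) auto
  have hm[measurable]: "h \<in> borel_measurable circ_m" using h by simp
  have Z: "{z. h z = 0} \<in> sets borel" by measurable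
  \<comment> \<open>By completeness, N is null once measurable sets of arbitrarily small measure
    cover it; measurability of N comes as part of the conclusion.\<close>
  have "N \<in> null_sets circ_m"
    unfolding circ.null_sets_outer
  proof (intro allI impI)
    fix \<delta> :: real assume "0 < \<delta>"
    \<comment> \<open>Chosen so that the weak type bound 20 / \<epsilon> * \<eta> equals \<delta> /
      2.\<close>
    define \<eta> where "\<eta> = \<delta> * \<epsilon> / 40"
    have \<eta>: "0 < \<eta>" using \<open>0 < \<delta>\<close> \<epsilon> by (simp add: \<eta>_def)
    have "emeasure \<mu> {z. h z = 0} = (\<integral>\<^sup>+z. ennreal (h z) * indicator {z. h z = 0} z \<partial>circ_b)"
      unfolding \<mu>_def by (subst emeasure_density) auto
    also have "\<dots> = (\<integral>\<^sup>+z. 0 \<partial>circ_b)"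
      by (intro nn_integral_cong) (auto simp: indicator_def)
    finally have "emeasure \<mu> {z. h z = 0} = 0" by simp
    then have "(INF U \<in> {U. {z. h z = 0} \<subseteq> U \<and> open U}. emeasure \<mu> U) < ennreal \<eta>"
      using outer_regular[OF sb fin Z] \<eta> by simp
    then obtain U where U: "{z. h z = 0} \<subseteq> U" "open U" "emeasure \<mu> U < ennreal \<eta>"
      unfolding INF_less_iff by auto
    have [measurable]: "U \<in> sets borel" using U by auto
    have Um[measurable]: "U \<in> sets circ_m" by (rule borel_sets_circ_m) measurable
    define g where "g z = h z * indicator U z" for z
    define k where "k z = h z * indicator (-U) z" for z
    have gk: "h = (\<lambda>z. g z + k z)"
      by (auto simp: g_def k_def indicator_def)
    have gi: "integrable circ_m g" 
      unfolding g_def using h(1) Um by (intro integrable_real_mult_indicator)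
    have ki: "integrable circ_m k"
      unfolding k_def using h(1) Um sets.compl_sets[OF Um] by (intro integrable_real_mult_indicator) (auto simp: Compl_eq_Diff_UNIV)
    have g0: "0 \<le> g z" and k0: "0 \<le> k z" for z using h(2) by (auto simp: g_def k_def)
    have "ennreal (LINT z|circ_m. g z) = (\<integral>\<^sup>+z. ennreal (g z) \<partial>circ_m)"
      using nn_integral_eq_integral[OF gi] g0 by simp
    also have "\<dots> = (\<integral>\<^sup>+z. ennreal (g z) \<partial>circ_b)"
      unfolding circ_m_eq by (rule nn_integral_completion)
    also have "\<dots> = emeasure \<mu> U"
      unfolding \<mu>_def by (subst emeasure_density) (auto simp: g_def indicator_def intro!: nn_integral_cong)
    also have "\<dots> < ennreal \<eta>" by fact
    finally have gI: "(LINT z|circ_m. g z) < \<eta>"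
      using g0 \<eta> by (simp add: ennreal_less_iff)
    obtain B where B: "B \<in> sets circ_m" "emeasure circ_m B \<le> ennreal (20 / \<epsilon> * (LINT \<zeta>|circ_m. g \<zeta>))"
      "\<And>z \<rho>. norm z = 1 \<Longrightarrow> z \<notin> B \<Longrightarrow> 0 < \<rho> \<Longrightarrow> emeasure (density circ_m g) (cball z \<rho>) \<le> ennreal (\<epsilon> * \<rho>)"
      using maximal_weak_type[OF gi g0 \<epsilon>] by blast
    have "emeasure circ_m B \<le> ennreal (20 / \<epsilon> * \<eta>)"
      using gI \<epsilon> by (intro order_trans[OF B(2)] ennreal_leI mult_left_mono) auto
    also have "20 / \<epsilon> * \<eta> = \<delta> / 2" using \<epsilon> by (simp add: \<eta>_def)
    finally have "measure circ_m B \<le> \<delta> / 2"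
      using \<open>0 < \<delta>\<close> by (simp add: circ.emeasure_eq_measure)
    moreover have "N \<subseteq> B"
    proof
      fix z assume z: "z \<in> N"
      show "z \<in> B"
      proof (rule ccontr)
        assume zB: "z \<notin> B"
        have nz: "norm z = 1" using z by (simp add: N_def)
        have "z \<in> U" using z U by (auto simp: N_def)
        then obtain d where d: "0 < d" "ball z d \<subseteq> U"
          using U(2) by (meson openE)
        have 1: "eventually (\<lambda>r. Re (herg k (of_real r * z)) < e / 2) (at_left 1)"
          using d \<open>0 < e\<close> by (intro Re_herg_tendsto_0_away[OF ki k0 nz, of d]) (auto simp: k_def indicator_def)
        have 2: "eventually (\<lambda>r. r \<in> {0<..<1}) (at_left (1::real))"
          by (intro eventually_at_left_real) auto
        have "eventually (\<lambda>r. Re (herg h (of_real r * z)) < e) (at_left 1)"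
          using 1 2
        proof eventually_elim
          case (elim r)
          have "Re (herg g (of_real r * z)) \<le> 64 * \<epsilon>"
            using elim \<epsilon> by (intro Re_herg_le_maximal[OF gi g0 nz] B(3)[OF nz zB]) auto
          then show ?case
            unfolding gk using elim herg_add[OF gi ki, of "of_real r * z"] nz
            by (simp add: norm_mult \<epsilon>_def)
        qed
        then show False using z by (simp add: N_def)
      qed
    qed
    ultimately show "\<exists>T\<in>fmeasurable circ_m. N \<subseteq> T \<and> measure circ_m T < \<delta>"
      using \<open>0 < \<delta>\<close> B(1) by (intro bexI[of _ B]) (auto simp: fmeasurable_def less_top[symmetric])
  qed
  then have "AE z in circ_m. z \<notin> N"
    by (rule AE_not_in)
  with AE_circ_m_sphere show ?thesis
    by eventually_elim (auto simp: N_def)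
qed

text \<open>A Lebesgue measurable h agrees almost everywhere with a Borel function, made nonnegative
  by \<open>max 0\<close>; Herglotz integrals do not see the change.\<close>

lemma radial_limit_zero_set:
  assumes h: "integrable circ_m h" "\<And>\<zeta>. 0 \<le> h \<zeta>" and "0 < e"
  shows "AE z in circ_m. h z = 0 \<longrightarrow> eventually (\<lambda>r. Re (herg h (of_real r * z)) < e) (at_left 1)"
proof -
  have "h \<in> borel_measurable (completion circ_b)"
    using h by (simp add: circ_m_eq[symmetric])
  then obtain h0 where h0: "h0 \<in> borel_measurable circ_b" "AE x in circ_b. h x = h0 x"
    using completion_ex_borel_measurable_real by blast
  define h1 where "h1 x = max 0 (h0 x)" for x
  have [measurable]: "h0 \<in> borel_measurable borel"
    using h0(1) by (simp cong: measurable_cong_sets)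
  have h1[measurable]: "h1 \<in> borel_measurable borel"
    unfolding h1_def by measurable
  have ae: "AE x in circ_m. h x = h1 x"
    using AE_completion[OF h0(2)] h(2) unfolding circ_m_eq[symmetric]
    by (auto simp: h1_def elim!: eventually_mono) (metis max.absorb2)
  note h1m = borel_measurable_circ_m[OF h1]
  have hm: "h \<in> borel_measurable circ_m" using h by simp
  have "integrable circ_m h1"
    using h(1) integrable_cong_AE[OF hm h1m ae] by simp
  moreover have "0 \<le> h1 x" for x by (simp add: h1_def)
  ultimately have "AE z in circ_m. h1 z = 0 \<longrightarrow> eventually (\<lambda>r. Re (herg h1 (of_real r * z)) < e) (at_left 1)"
    using h1 \<open>0 < e\<close> by (intro radial_limit_zero_set_borel) auto
  with ae AE_circ_m_sphere show ?thesis
  proof eventually_elim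
    case (elim z)
    show ?case
    proof
      assume "h z = 0"
      with elim have ev: "eventually (\<lambda>r. Re (herg h1 (of_real r * z)) < e) (at_left 1)" by simp
      have "eventually (\<lambda>r. r \<in> {0<..<1}) (at_left (1::real))"
        by (intro eventually_at_left_real) auto
      with ev show "eventually (\<lambda>r. Re (herg h (of_real r * z)) < e) (at_left 1)"
      proof eventually_elim
        case (elim r)
        then have "herg h (of_real r * z) = herg h1 (of_real r * z)"
          using \<open>norm z = 1\<close> by (intro herg_cong_AE ae hm h1m) (auto simp: norm_mult)
        with elim show ?case by simp
      qed
    qed
  qed
qed

text \<open>For a rational c just above f z, f is at most c plus the positive part of f - c, and
  this positive part vanishes at z, so \<open>radial_limit_zero_set\<close> applies to it. Rational
  c and tolerances 1 / (n + 1) keep the exceptional set a countable union of null sets.\<close>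

lemma radial_limsup_le:
  assumes f: "integrable circ_m f"
  shows "AE z in circ_m. \<forall>e>0. eventually (\<lambda>r. Re (herg f (of_real r * z)) < f z + e) (at_left 1)"
proof -
  have "AE z in circ_m. \<forall>c::rat. \<forall>n::nat. f z \<le> of_rat c \<longrightarrow>
      eventually (\<lambda>r. Re (herg (\<lambda>x. max 0 (f x - of_rat c)) (of_real r * z)) < 1 / Suc n) (at_left 1)"
    unfolding AE_all_countable
  proof (intro allI)
    fix c :: rat and n :: nat
    have "AE z in circ_m. max 0 (f z - of_rat c) = 0 \<longrightarrow>
      eventually (\<lambda>r. Re (herg (\<lambda>x. max 0 (f x - of_rat c)) (of_real r * z)) < 1 / Suc n) (at_left 1)"
      using f by (intro radial_limit_zero_set) auto
    then show "AE z in circ_m. f z \<le> of_rat c \<longrightarrow>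
      eventually (\<lambda>r. Re (herg (\<lambda>x. max 0 (f x - of_rat c)) (of_real r * z)) < 1 / Suc n) (at_left 1)"
      by eventually_elim auto
  qed
  with AE_circ_m_sphere show ?thesis
  proof eventually_elim
    case (elim z)
    show ?case
    proof (intro allI impI)
      fix e :: real assume "0 < e"
      obtain c where c: "f z < of_rat c" "of_rat c < f z + e / 2"
        using of_rat_dense[of "f z" "f z + e / 2"] \<open>0 < e\<close> by auto
      obtain n where n: "1 / real (Suc n) < e / 2"
        using nat_approx_posE[of "e / 2"] \<open>0 < e\<close> by auto
      have ev: "eventually (\<lambda>r. Re (herg (\<lambda>x. max 0 (f x - of_rat c)) (of_real r * z)) < 1 / Suc n) (at_left 1)"
        using elim c by auto
      have "eventually (\<lambda>r. r \<in> {0<..<1}) (at_left (1::real))"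
        by (intro eventually_at_left_real) auto
      with ev show "eventually (\<lambda>r. Re (herg f (of_real r * z)) < f z + e) (at_left 1)"
      proof eventually_elim
        case (elim r)
        have nz: "norm (of_real r * z) < 1"
          using elim \<open>norm z = 1\<close> by (simp add: norm_mult)
        have "Re (herg f (of_real r * z)) \<le> Re (herg (\<lambda>x. of_rat c + max 0 (f x - of_rat c)) (of_real r * z))"
          using f nz by (intro Re_herg_mono) auto
        also have "\<dots> = Re (herg (\<lambda>x. of_rat c) (of_real r * z)) + Re (herg (\<lambda>x. max 0 (f x - of_rat c)) (of_real r * z))"
          using f nz by (subst herg_add) auto
        also have "Re (herg (\<lambda>x. of_rat c) (of_real r * z)) = of_rat c"
          using nz integral_pois[OF nz] by (subst Re_herg) auto
        finally show ?case using elim c n by linarith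
      qed
    qed
  qed
qed

text \<open>The upper estimate for - f is the lower estimate for f.\<close>

lemma Fatou_radial_limit:
  assumes f: "integrable circ_m f"
  shows "AE z in circ_m. ((\<lambda>r. Re (herg f (of_real r * z))) \<longlongrightarrow> f z) (at_left 1)"
  using radial_limsup_le[OF f] radial_limsup_le[OF integrable_minus[OF f]]
proof eventually_elim
  case (elim z)
  show ?case
  proof (rule tendstoI)
    fix e :: real assume "0 < e"
    then have "eventually (\<lambda>r. Re (herg f (of_real r * z)) < f z + e) (at_left 1)"
      "eventually (\<lambda>r. Re (herg (\<lambda>z. - f z) (of_real r * z)) < - f z + e) (at_left 1)"
      using elim by auto
    then show "eventually (\<lambda>r. dist (Re (herg f (of_real r * z))) (f z) < e) (at_left 1)"
      by eventually_elim (auto simp: herg_minus dist_real_def)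
  qed
qed

section \<open>Conjugate functions and L log L\<close>

text \<open>The difference of the two sides is the primitive of \<open>arctan\<close> that vanishes
  at 0. It is the correction term in \<open>Re_mult_Ln_eq\<close>.\<close>

lemma arctan_primitive_nonneg:
  fixes s :: real assumes "0 \<le> s" shows "ln (1 + s\<^sup>2) / 2 \<le> s * arctan s"
proof -
  let ?f = "\<lambda>s::real. s * arctan s - ln (1 + s\<^sup>2) / 2"
  have "?f 0 \<le> ?f s"
  proof (rule DERIV_nonneg_imp_nondecreasing[OF assms])
    fix x :: real assume "0 \<le> x"
    have "1 + x\<^sup>2 > 0" by (smt (verit) zero_le_power2)
    then have "(?f has_real_derivative arctan x) (at x)"
      by (auto intro!: derivative_eq_intros simp: divide_simps)
    with \<open>0 \<le> x\<close> show "\<exists>y. (?f has_real_derivative y) (at x) \<and> 0 \<le> y"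
      by (intro exI[of _ "arctan x"]) auto
  qed
  then show ?thesis by simp
qed

text \<open>Beyond 1 the slope arctan s is at least pi / 4 > 1 / 2, so the primitive outgrows s / 2;
  up to 1 the left side is negative. Both sides are even in s.\<close>

lemma arctan_primitive_lower:
  fixes s :: real shows "\<bar>s\<bar> / 2 - 1 \<le> s * arctan s - ln (1 + s\<^sup>2) / 2"
proof -
  let ?f = "\<lambda>s::real. s * arctan s - ln (1 + s\<^sup>2) / 2 - s / 2"
  have pos: "s / 2 - 1 \<le> s * arctan s - ln (1 + s\<^sup>2) / 2" if "0 \<le> s" for s :: real
  proof (cases "s \<le> 1")
    case True
    then show ?thesis using arctan_primitive_nonneg[OF that] by simp
  next
    case False
    have "?f 1 \<le> ?f s"
    proof (rule DERIV_nonneg_imp_nondecreasing[where f = ?f and a = 1 and b = s])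
      fix x :: real assume "1 \<le> x"
      have "1 + x\<^sup>2 > 0" by (smt (verit) zero_le_power2)
      then have "(?f has_real_derivative arctan x - 1 / 2) (at x)"
        by (auto intro!: derivative_eq_intros simp: divide_simps)
      moreover have "arctan 1 \<le> arctan x" using \<open>1 \<le> x\<close> by (simp only: arctan_le_iff)
      then have "1 / 2 \<le> arctan x"
        using pi_gt3 by (simp add: arctan_one)
      ultimately show "\<exists>y. (?f has_real_derivative y) (at x) \<and> 0 \<le> y"
        by (intro exI[of _ "arctan x - 1 / 2"]) auto
    qed (use False in simp)
    then show ?thesis using arctan_primitive_nonneg[of 1] by simp
  qed
  from pos[of "\<bar>s\<bar>"] show ?thesis
    by (cases "0 \<le> s") (auto simp: arctan_minus)
qed

text \<open>Write g = x (1 + i s) with x > 0; then Ln g = ln x + ln (1 + s^2) / 2 + i arctan s, and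
  the real part of the product is read off.\<close>

lemma Re_mult_Ln_eq:
  assumes "0 < Re g"
  shows "Re (g * Ln g) = Re g * ln (Re g)
     - Re g * (Im g / Re g * arctan (Im g / Re g) - ln (1 + (Im g / Re g)\<^sup>2) / 2)"
proof -
  define x s where "x = Re g" and "s = Im g / Re g"
  have x: "0 < x" using assms by (simp add: x_def)
  have s: "1 + s\<^sup>2 > 0" by (smt (verit) zero_le_power2)
  have g: "g = Complex x (x * s)"
    using assms by (simp add: x_def s_def complex_eq_iff)
  define L where "L = Complex (ln x + ln (1 + s\<^sup>2) / 2) (arctan s)"
  have "exp (ln (1 + s\<^sup>2) / 2) = sqrt (1 + s\<^sup>2)"
    using s by (simp add: ln_sqrt[symmetric])
  then have "exp (Re L) = x * sqrt (1 + s\<^sup>2)"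
    using x by (simp add: L_def exp_add)
  then have "exp L = g"
    using s unfolding exp_eq_polar g
    by (auto simp: complex_eq_iff L_def cos_arctan sin_arctan)
  moreover have "- pi < Im L" "Im L \<le> pi"
    using arctan_bounded[of s] by (auto simp: L_def)
  ultimately have "Ln g = L"
    using Ln_exp by metis
  then have "Re (g * Ln g) = x * ln x - x * (s * arctan s - ln (1 + s\<^sup>2) / 2)"
    by (simp add: g L_def algebra_simps)
  then show ?thesis by (simp add: x_def s_def)
qed

text \<open>Pointwise half of Zygmund's inequality: Re g times the primitive of arctan at Im g / Re
  g is at least |Im g| / 2 - Re g.\<close>

lemma Im_le_Re_mult_Ln:
  assumes "0 < Re g"
  shows "\<bar>Im g\<bar> \<le> 2 * (Re g * ln (Re g) - Re (g * Ln g)) + 2 * Re g"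
proof -
  define K where "K = Im g / Re g * arctan (Im g / Re g) - ln (1 + (Im g / Re g)\<^sup>2) / 2"
  have "Re g * (\<bar>Im g / Re g\<bar> / 2 - 1) \<le> Re g * K"
    unfolding K_def using assms by (intro mult_left_mono arctan_primitive_lower) auto
  moreover have "Re g * (\<bar>Im g / Re g\<bar> / 2 - 1) = \<bar>Im g\<bar> / 2 - Re g"
    using assms by (simp add: abs_divide field_simps)
  ultimately have "\<bar>Im g\<bar> / 2 - Re g \<le> Re g * K" by simp
  then show ?thesis
    unfolding Re_mult_Ln_eq[OF assms, folded K_def] by simp
qed

text \<open>The opposite half: |arctan| < pi / 2 bounds the correction term by pi / 2 * |Im
  g|.\<close>

lemma Re_mult_Ln_ge:
  assumes "0 < Re g"
  shows "Re g * ln (Re g) \<le> Re (g * Ln g) + pi / 2 * \<bar>Im g\<bar>"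
proof -
  let ?s = "Im g / Re g"
  have "ln (1 + ?s\<^sup>2) \<ge> 0" by simp
  moreover have "?s * arctan ?s \<le> \<bar>?s\<bar> * (pi / 2)"
  proof -
    have "?s * arctan ?s \<le> \<bar>?s\<bar> * \<bar>arctan ?s\<bar>"
      by (metis abs_ge_self abs_mult)
    also have "\<dots> \<le> \<bar>?s\<bar> * (pi / 2)"
      using arctan_bounded[of ?s] by (intro mult_left_mono) auto
    finally show ?thesis .
  qed
  ultimately have "?s * arctan ?s - ln (1 + ?s\<^sup>2) / 2 \<le> \<bar>?s\<bar> * (pi / 2)"
    by linarith
  then have "Re g * (?s * arctan ?s - ln (1 + ?s\<^sup>2) / 2) \<le> Re g * (\<bar>?s\<bar> * (pi / 2))"
    using assms by (intro mult_left_mono) auto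
  also have "\<dots> = pi / 2 * \<bar>Im g\<bar>"
    using assms by (simp add: abs_divide field_simps)
  finally show ?thesis
    using Re_mult_Ln_eq[OF assms] by linarith
qed

text \<open>The function x ln x shifted by 1, so that \<open>phi (Re H)\<close> is Re G ln (Re G)
  for G = 1 + H. On the nonnegative reals it is nonnegative, increasing and convex, and it grows
  like x ln x.\<close>

definition phi :: "real \<Rightarrow> real" where "phi x = (1 + x) * ln (1 + x)"

lemma phi_nonneg: "0 \<le> x \<Longrightarrow> 0 \<le> phi x"
  by (simp add: phi_def)

lemma phi_measurable [measurable]: "phi \<in> borel_measurable borel"
  unfolding phi_def[abs_def] by measurable

lemma phi_mono: "0 \<le> x \<Longrightarrow> x \<le> y \<Longrightarrow> phi x \<le> phi y"
  unfolding phi_def by (intro mult_mono) auto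

text \<open>Convexity as a tangent line inequality with slope phi'(x) = 1 + ln (1 + x); it is ln t
  \<le> t - 1 at t = (1 + x) / (1 + y).\<close>

lemma phi_tangent:
  assumes "0 \<le> x" "0 \<le> y"
  shows "phi x + (1 + ln (1 + x)) * (y - x) \<le> phi y"
proof -
  have "ln ((1 + x) / (1 + y)) \<le> (1 + x) / (1 + y) - 1"
    using assms by (intro ln_le_minus_one) auto
  then have "ln (1 + x) - ln (1 + y) \<le> (x - y) / (1 + y)"
    using assms by (simp add: ln_div field_simps)
  then have "(1 + y) * (ln (1 + x) - ln (1 + y)) \<le> x - y"
    using assms by (simp add: field_simps)
  then show ?thesis by (simp add: phi_def algebra_simps)
qed

section \<open>Jensen's and Zygmund's inequalities for circle means\<close>

lemma herg_const: "norm z < 1 \<Longrightarrow> Re (herg (\<lambda>_. c) z) = c"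
  using integral_pois[of z] by (subst Re_herg) auto

lemma Re_herg_nonneg:
  assumes "integrable circ_m f" "\<And>\<zeta>. 0 \<le> f \<zeta>" "norm z < 1"
  shows "0 \<le> Re (herg f z)"
  using Re_herg_mono[of "\<lambda>_. 0" f z] assms herg_const[of z 0] by auto

text \<open>The Poisson kernel is a probability density, so the tangent line of \<open>phi\<close>
  at the Poisson mean of v may be integrated against it.\<close>

lemma Jensen_herg:
  assumes v: "integrable circ_m v" "\<And>\<zeta>. 0 \<le> v \<zeta>" and pv: "integrable circ_m (\<lambda>\<zeta>. phi (v \<zeta>))" and z: "norm z < 1"
  shows "phi (Re (herg v z)) \<le> Re (herg (\<lambda>\<zeta>. phi (v \<zeta>)) z)"
proof -
  define x where "x = Re (herg v z)"
  have x: "0 \<le> x" unfolding x_def by (intro Re_herg_nonneg v z)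
  define c where "c = 1 + ln (1 + x)"
  have i: "integrable circ_m (\<lambda>\<zeta>. (phi x - c * x) + c * v \<zeta>)" using v by auto
  have "Re (herg (\<lambda>\<zeta>. (phi x - c * x) + c * v \<zeta>) z) \<le> Re (herg (\<lambda>\<zeta>. phi (v \<zeta>)) z)"
  proof (rule Re_herg_mono[OF i pv z AE_I2])
    fix \<zeta>
    show "(phi x - c * x) + c * v \<zeta> \<le> phi (v \<zeta>)"
      using phi_tangent[OF x v(2)[of \<zeta>]] by (simp add: c_def algebra_simps)
  qed
  moreover have "Re (herg (\<lambda>\<zeta>. (phi x - c * x) + c * v \<zeta>) z) = phi x"
    using v z by (subst herg_add) (auto simp: herg_const herg_cmult x_def)
  ultimately show ?thesis by (simp add: x_def)
qed

lemma norm_dilate_less: "norm \<zeta> = 1 \<Longrightarrow> \<bar>r\<bar> < 1 \<Longrightarrow> norm (complex_of_real r * \<zeta>) < 1"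
  by (simp add: norm_mult)

lemma dilation_continuous:
  assumes "f holomorphic_on ball 0 1" "\<bar>r\<bar> < 1"
  shows "continuous_on (sphere 0 1) (\<lambda>\<zeta>. f (of_real r * \<zeta>))"
  by (intro continuous_on_subset[OF holomorphic_dilation(2)[OF assms]]) auto

lemma Re_herg_dilation_mean:
  assumes "integrable circ_m f" "\<bar>r\<bar> < 1"
  shows "(LINT \<zeta>|circ_m. Re (herg f (of_real r * \<zeta>))) = (LINT \<zeta>|circ_m. f \<zeta>)"
    "integrable circ_m (\<lambda>\<zeta>. herg f (of_real r * \<zeta>))"
proof -
  note h = herg_holomorphic[OF assms(1)]
  show "integrable circ_m (\<lambda>\<zeta>. herg f (of_real r * \<zeta>))"
    by (rule dilation_integrable[OF h assms(2)])
  then show "(LINT \<zeta>|circ_m. Re (herg f (of_real r * \<zeta>))) = (LINT \<zeta>|circ_m. f \<zeta>)"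
    using dilation_mean_value[OF h assms(2)] herg_0[OF assms(1)] by (simp add: integral_Re)
qed

text \<open>Since 1 + H has real part at least 1, the principal branch makes g holomorphic, and its
  circle means equal its value at the origin, which is real because H is real there.\<close>

lemma one_plus_herg_Ln:
  assumes v: "integrable circ_m v" "\<And>\<zeta>. 0 \<le> v \<zeta>" and r: "\<bar>r\<bar> < 1"
  defines "g \<equiv> \<lambda>z. (1 + herg v z) * Ln (1 + herg v z)"
  shows "integrable circ_m (\<lambda>\<zeta>. Re (g (of_real r * \<zeta>)))"
    "(LINT \<zeta>|circ_m. Re (g (of_real r * \<zeta>))) = phi (LINT \<zeta>|circ_m. v \<zeta>)"
proof -
  have "1 + herg v z \<notin> \<real>\<^sub>\<le>\<^sub>0" if "norm z < 1" for z
    using Re_herg_nonneg[OF v that] by (auto simp: complex_nonpos_Reals_iff)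
  then have h: "g holomorphic_on ball 0 1"
    unfolding g_def by (intro holomorphic_intros herg_holomorphic v) auto
  note i = dilation_integrable[OF h r]
  show "integrable circ_m (\<lambda>\<zeta>. Re (g (of_real r * \<zeta>)))"
    using i by simp
  have "(LINT \<zeta>|circ_m. Re (g (of_real r * \<zeta>))) = Re (g 0)"
    using dilation_mean_value[OF h r] i by (simp add: integral_Re)
  also have "\<dots> = phi (LINT \<zeta>|circ_m. v \<zeta>)"
  proof -
    define a where "a = (LINT \<zeta>|circ_m. v \<zeta>)"
    have "0 \<le> a" unfolding a_def using v by simp
    have "1 + herg v 0 = of_real (1 + a)"
      using herg_0[OF v(1)] by (simp add: a_def)
    then have "g 0 = of_real (1 + a) * of_real (ln (1 + a))"
      unfolding g_def using \<open>0 \<le> a\<close> by (simp only:) (simp only: Ln_of_real)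
    then have "g 0 = of_real (phi a)"
      by (simp add: phi_def)
    then show ?thesis by (simp add: a_def)
  qed
  finally show "(LINT \<zeta>|circ_m. Re (g (of_real r * \<zeta>))) = phi (LINT \<zeta>|circ_m. v \<zeta>)" .
qed

text \<open>Integrate \<open>Im_le_Re_mult_Ln\<close> for G = 1 + H. Jensen replaces
  \<open>phi\<close> of the Poisson mean by the Poisson mean of \<open>phi (v \<zeta>)\<close>,
  whose circle means are constant; the mean of Re (G Ln G) is nonnegative and enters with a minus
  sign.\<close>

lemma conjugate_L1_bound:
  assumes v: "integrable circ_m v" "\<And>\<zeta>. 0 \<le> v \<zeta>" and pv: "integrable circ_m (\<lambda>\<zeta>. phi (v \<zeta>))" and r: "\<bar>r\<bar> < 1"
  shows "(LINT \<zeta>|circ_m. \<bar>Im (herg v (of_real r * \<zeta>))\<bar>)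
     \<le> 2 * (LINT \<zeta>|circ_m. phi (v \<zeta>)) + 2 * (1 + (LINT \<zeta>|circ_m. v \<zeta>))"
proof -
  define g where "g = (\<lambda>z. (1 + herg v z) * Ln (1 + herg v z))"
  have gi: "integrable circ_m (\<lambda>\<zeta>. Re (g (of_real r * \<zeta>)))"
    "(LINT \<zeta>|circ_m. Re (g (of_real r * \<zeta>))) = phi (LINT \<zeta>|circ_m. v \<zeta>)"
    unfolding g_def using one_plus_herg_Ln[OF v r] by blast+
  note vi = Re_herg_dilation_mean[OF v(1) r]
  note pi = Re_herg_dilation_mean[OF pv r]
  have "(LINT \<zeta>|circ_m. \<bar>Im (herg v (of_real r * \<zeta>))\<bar>)
    \<le> (LINT \<zeta>|circ_m. 2 * (Re (herg (\<lambda>\<zeta>. phi (v \<zeta>)) (of_real r * \<zeta>)) - Re (g (of_real r * \<zeta>)))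
         + 2 * (1 + Re (herg v (of_real r * \<zeta>))))"
  proof (rule integral_mono_AE)
    show "AE \<zeta> in circ_m. \<bar>Im (herg v (of_real r * \<zeta>))\<bar> \<le>
        2 * (Re (herg (\<lambda>\<zeta>. phi (v \<zeta>)) (of_real r * \<zeta>)) - Re (g (of_real r * \<zeta>)))
         + 2 * (1 + Re (herg v (of_real r * \<zeta>)))"
      using AE_circ_m_sphere
    proof eventually_elim
      case (elim \<zeta>)
      note nz = norm_dilate_less[OF elim r]
      show ?case
        using Im_le_Re_mult_Ln[of "1 + herg v (of_real r * \<zeta>)"] Re_herg_nonneg[OF v nz]
          Jensen_herg[OF v pv nz] by (simp add: g_def phi_def)
    qed
    show "integrable circ_m (\<lambda>\<zeta>. \<bar>Im (herg v (of_real r * \<zeta>))\<bar>)"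
      using vi(2) by auto
    show "integrable circ_m (\<lambda>\<zeta>. 2 * (Re (herg (\<lambda>\<zeta>. phi (v \<zeta>)) (of_real r * \<zeta>)) - Re (g (of_real r * \<zeta>)))
         + 2 * (1 + Re (herg v (of_real r * \<zeta>))))"
      using vi(2) pi(2) gi(1) by auto
  qed
  also have "\<dots> = 2 * ((LINT \<zeta>|circ_m. phi (v \<zeta>)) - phi (LINT \<zeta>|circ_m. v \<zeta>)) + 2 * (1 + (LINT \<zeta>|circ_m. v \<zeta>))"
    using vi pi gi by simp
  also have "\<dots> \<le> 2 * (LINT \<zeta>|circ_m. phi (v \<zeta>)) + 2 * (1 + (LINT \<zeta>|circ_m. v \<zeta>))"
    using phi_nonneg[of "LINT \<zeta>|circ_m. v \<zeta>"] v by simp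
  finally show ?thesis .
qed

text \<open>The converse direction, from \<open>Re_mult_Ln_ge\<close>. The left side is a
  nonnegative integral because it enters Fatou's lemma in
  \<open>conjugate_bounded_imp_LlogL\<close>.\<close>

lemma phi_mean_le_conjugate:
  assumes v: "integrable circ_m v" "\<And>\<zeta>. 0 \<le> v \<zeta>" and r: "\<bar>r\<bar> < 1"
  shows "(\<integral>\<^sup>+\<zeta>. phi (Re (herg v (of_real r * \<zeta>))) \<partial>circ_m)
    \<le> ennreal (phi (LINT \<zeta>|circ_m. v \<zeta>) + pi / 2 * (LINT \<zeta>|circ_m. \<bar>Im (herg v (of_real r * \<zeta>))\<bar>))"
proof -
  define g where "g = (\<lambda>z. (1 + herg v z) * Ln (1 + herg v z))"
  have gi: "integrable circ_m (\<lambda>\<zeta>. Re (g (of_real r * \<zeta>)))"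
    "(LINT \<zeta>|circ_m. Re (g (of_real r * \<zeta>))) = phi (LINT \<zeta>|circ_m. v \<zeta>)"
    unfolding g_def using one_plus_herg_Ln[OF v r] by blast+
  note vi = Re_herg_dilation_mean[OF v(1) r]
  define k where "k \<zeta> = Re (g (of_real r * \<zeta>)) + pi / 2 * \<bar>Im (herg v (of_real r * \<zeta>))\<bar>" for \<zeta>
  have ki: "integrable circ_m k"
    unfolding k_def using vi gi by auto
  have ae: "AE \<zeta> in circ_m. phi (Re (herg v (of_real r * \<zeta>))) \<le> k \<zeta> \<and> 0 \<le> k \<zeta>"
    using AE_circ_m_sphere
  proof eventually_elim
    case (elim \<zeta>)
    note nz = norm_dilate_less[OF elim r]
    have "phi (Re (herg v (of_real r * \<zeta>))) \<le> k \<zeta>"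
      using Re_mult_Ln_ge[of "1 + herg v (of_real r * \<zeta>)"] Re_herg_nonneg[OF v nz]
      by (simp add: g_def phi_def k_def)
    with phi_nonneg[OF Re_herg_nonneg[OF v nz]] show ?case
      by simp
  qed
  have "(\<integral>\<^sup>+\<zeta>. phi (Re (herg v (of_real r * \<zeta>))) \<partial>circ_m) \<le> (\<integral>\<^sup>+\<zeta>. k \<zeta> \<partial>circ_m)"
    using ae by (intro nn_integral_mono_AE) (auto elim!: eventually_mono intro: ennreal_leI)
  also have "\<dots> = ennreal (LINT \<zeta>|circ_m. k \<zeta>)"
    using ae by (intro nn_integral_eq_integral ki) (auto elim: eventually_mono)
  also have "(LINT \<zeta>|circ_m. k \<zeta>) = phi (LINT \<zeta>|circ_m. v \<zeta>) + pi / 2 * (LINT \<zeta>|circ_m. \<bar>Im (herg v (of_real r * \<zeta>))\<bar>)"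
    unfolding k_def using vi gi by simp
  finally show ?thesis .
qed

section \<open>L^1 convergence of the dilated conjugate function\<close>

definition radius :: "nat \<Rightarrow> real" where "radius k = 1 - 1 / real (k + 2)"

text \<open>The offset 2 in \<open>radius\<close> makes even the first radius positive: it is 1 /
  2.\<close>

lemma radius_bounds: "0 < radius k" "radius k < 1" "\<bar>radius k\<bar> < 1"
  by (auto simp: radius_def field_simps abs_if)

lemma radius_tendsto: "filterlim radius (at_left 1) sequentially"
proof -
  have "(\<lambda>k. 1 / real (k + 2)) \<longlonglongrightarrow> 0"
    using LIMSEQ_ignore_initial_segment[OF lim_1_over_n, of 2] by simp
  then have "radius \<longlonglongrightarrow> 1 - 0"
    unfolding radius_def[abs_def] by (intro tendsto_intros)
  then show ?thesis
    by (intro tendsto_imp_filterlim_at_left) (auto simp: radius_bounds)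
qed

text \<open>The square of the difference of two dilations is holomorphic and vanishes at 0.\<close>

lemma dilation_conjugate_square_mean:
  assumes v: "integrable circ_m v" and r: "\<bar>r\<bar> < 1" "\<bar>s\<bar> < 1"
  shows "(LINT \<zeta>|circ_m. (Im (herg v (of_real r * \<zeta>)) - Im (herg v (of_real s * \<zeta>)))\<^sup>2)
       = (LINT \<zeta>|circ_m. (Re (herg v (of_real r * \<zeta>)) - Re (herg v (of_real s * \<zeta>)))\<^sup>2)"
proof -
  note h = herg_holomorphic[OF v]
  define D where "D \<zeta> = herg v (of_real r * \<zeta>) - herg v (of_real s * \<zeta>)" for \<zeta>
  have c: "continuous_on (cball 0 1) D" "D holomorphic_on ball 0 1"
    unfolding D_def by (intro continuous_intros holomorphic_intros holomorphic_dilation[OF h] r)+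
  have cs: "continuous_on (sphere 0 1) D"
    using c(1) by (rule continuous_on_subset) auto
  have i: "integrable circ_m (\<lambda>\<zeta>. (Im (D \<zeta>))\<^sup>2)" "integrable circ_m (\<lambda>\<zeta>. (Re (D \<zeta>))\<^sup>2)" "integrable circ_m (\<lambda>\<zeta>. (D \<zeta>)\<^sup>2)"
    by (intro integrable_circ_m_continuous continuous_intros cs)+
  have "(LINT \<zeta>|circ_m. (D \<zeta>)\<^sup>2) = (D 0)\<^sup>2"
    using circ_m_mean_value[of "\<lambda>\<zeta>. (D \<zeta>)\<^sup>2"] c by (auto intro!: continuous_intros holomorphic_intros)
  also have "D 0 = 0" by (simp add: D_def)
  finally have "Re (LINT \<zeta>|circ_m. (D \<zeta>)\<^sup>2) = 0" by simp
  then have "(LINT \<zeta>|circ_m. Re ((D \<zeta>)\<^sup>2)) = 0"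
    using integral_Re[OF i(3)] by simp
  moreover have "Re ((D \<zeta>)\<^sup>2) = (Re (D \<zeta>))\<^sup>2 - (Im (D \<zeta>))\<^sup>2" for \<zeta>
    by (simp add: power2_eq_square)
  ultimately have "(LINT \<zeta>|circ_m. (Im (D \<zeta>))\<^sup>2) = (LINT \<zeta>|circ_m. (Re (D \<zeta>))\<^sup>2)"
    using i by simp
  then show ?thesis by (simp add: D_def)
qed

lemma integrable_Im_herg_dilation:
  assumes "integrable circ_m v" "\<bar>r\<bar> < 1"
  shows "integrable circ_m (\<lambda>\<zeta>. Im (herg v (of_real r * \<zeta>)))"
  using Re_herg_dilation_mean(2)[OF assms] by simp

text \<open>For bounded v the real parts converge to v in L^2, by radial limits and dominated
  convergence. \<open>dilation_conjugate_square_mean\<close> carries the Cauchy property over to the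
  imaginary parts.\<close>

lemma conjugate_Cauchy_bounded:
  assumes v: "integrable circ_m v" "\<And>\<zeta>. 0 \<le> v \<zeta>" "\<And>\<zeta>. v \<zeta> \<le> M" and "0 < e"
  shows "\<exists>K. \<forall>j\<ge>K. \<forall>k\<ge>K. (LINT \<zeta>|circ_m. \<bar>Im (herg v (of_real (radius j) * \<zeta>)) - Im (herg v (of_real (radius k) * \<zeta>))\<bar>) < e"
proof -
  define u where "u k \<zeta> = herg v (of_real (radius k) * \<zeta>)" for k \<zeta>
  have cu: "continuous_on (sphere 0 1) (u k)" for k
    unfolding u_def by (intro dilation_continuous herg_holomorphic v radius_bounds)
  have M: "0 \<le> M" using v(2)[of 0] v(3)[of 0] by linarith
  have [measurable]: "v \<in> borel_measurable circ_m" "u k \<in> borel_measurable circ_m" for k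
    using v(1) borel_measurable_circ_m_continuous[OF cu] by auto
  have uM: "AE \<zeta> in circ_m. \<bar>Re (u k \<zeta>) - v \<zeta>\<bar> \<le> M" for k
    using AE_circ_m_sphere
  proof eventually_elim
    case (elim \<zeta>)
    note nz = norm_dilate_less[OF elim radius_bounds(3), of k]
    have "Re (u k \<zeta>) \<le> Re (herg (\<lambda>_. M) (of_real (radius k) * \<zeta>))"
      unfolding u_def using v by (intro Re_herg_mono nz) auto
    then have "Re (u k \<zeta>) \<le> M" using herg_const[OF nz] by simp
    moreover have "0 \<le> Re (u k \<zeta>)"
      unfolding u_def by (intro Re_herg_nonneg v nz)
    ultimately show ?case using v(2)[of \<zeta>] v(3)[of \<zeta>] by linarith
  qed
  have sq: "AE \<zeta> in circ_m. norm ((Re (u k \<zeta>) - v \<zeta>)\<^sup>2) \<le> M\<^sup>2" for k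
    using uM[of k] by eventually_elim (simp add: abs_le_square_iff[symmetric] M)
  have sqi: "integrable circ_m (\<lambda>\<zeta>. (Re (u k \<zeta>) - v \<zeta>)\<^sup>2)" for k
    by (rule circ.integrable_const_bound[OF sq]) measurable
  have "(\<lambda>k. LINT \<zeta>|circ_m. (Re (u k \<zeta>) - v \<zeta>)\<^sup>2) \<longlonglongrightarrow> (LINT \<zeta>|circ_m. 0)"
  proof (rule integral_dominated_convergence)
    show "AE \<zeta> in circ_m. (\<lambda>k. (Re (u k \<zeta>) - v \<zeta>)\<^sup>2) \<longlonglongrightarrow> 0"
      using Fatou_radial_limit[OF v(1)]
    proof eventually_elim
      case (elim \<zeta>)
      have "(\<lambda>k. (Re (u k \<zeta>) - v \<zeta>)\<^sup>2) \<longlonglongrightarrow> (v \<zeta> - v \<zeta>)\<^sup>2"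
        unfolding u_def by (intro tendsto_intros filterlim_compose[OF elim radius_tendsto])
      then show ?case by simp
    qed
  qed (use sq in auto)
  then have lim: "(\<lambda>k. LINT \<zeta>|circ_m. (Re (u k \<zeta>) - v \<zeta>)\<^sup>2) \<longlonglongrightarrow> 0" by simp
  \<comment> \<open>Two terms 2 * (e^2 / 8) add up to e^2 / 2 for the square mean, and then e / 2 +
    (e^2 / 2) / (2 e) = 3 e / 4 for the mean.\<close>
  have "0 < e\<^sup>2 / 8" using \<open>0 < e\<close> by simp
  with order_tendstoD(2)[OF lim, of "e\<^sup>2 / 8"]
  obtain K where K: "\<And>k. k \<ge> K \<Longrightarrow> (LINT \<zeta>|circ_m. (Re (u k \<zeta>) - v \<zeta>)\<^sup>2) < e\<^sup>2 / 8"
    unfolding eventually_sequentially by blast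
  have "(LINT \<zeta>|circ_m. \<bar>Im (u j \<zeta>) - Im (u k \<zeta>)\<bar>) < e" if jk: "j \<ge> K" "k \<ge> K" for j k
  proof -
    have ci: "continuous_on (sphere 0 1) (\<lambda>\<zeta>. (Im (u j \<zeta>) - Im (u k \<zeta>))\<^sup>2)"
      "continuous_on (sphere 0 1) (\<lambda>\<zeta>. (Re (u j \<zeta>) - Re (u k \<zeta>))\<^sup>2)"
      "continuous_on (sphere 0 1) (\<lambda>\<zeta>. \<bar>Im (u j \<zeta>) - Im (u k \<zeta>)\<bar>)"
      by (intro continuous_intros cu)+
    note ii = ci[THEN integrable_circ_m_continuous]
    have "(LINT \<zeta>|circ_m. (Im (u j \<zeta>) - Im (u k \<zeta>))\<^sup>2) = (LINT \<zeta>|circ_m. (Re (u j \<zeta>) - Re (u k \<zeta>))\<^sup>2)"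
      unfolding u_def by (intro dilation_conjugate_square_mean v radius_bounds)
    also have "\<dots> \<le> (LINT \<zeta>|circ_m. 2 * (Re (u j \<zeta>) - v \<zeta>)\<^sup>2 + 2 * (Re (u k \<zeta>) - v \<zeta>)\<^sup>2)"
    proof (rule integral_mono)
      fix \<zeta>
      have "0 \<le> ((Re (u j \<zeta>) - v \<zeta>) + (Re (u k \<zeta>) - v \<zeta>))\<^sup>2" by simp
      then show "(Re (u j \<zeta>) - Re (u k \<zeta>))\<^sup>2 \<le> 2 * (Re (u j \<zeta>) - v \<zeta>)\<^sup>2 + 2 * (Re (u k \<zeta>) - v \<zeta>)\<^sup>2"
        by (simp add: power2_eq_square algebra_simps)
    qed (use ii sqi in auto)
    also have "\<dots> = 2 * (LINT \<zeta>|circ_m. (Re (u j \<zeta>) - v \<zeta>)\<^sup>2) + 2 * (LINT \<zeta>|circ_m. (Re (u k \<zeta>) - v \<zeta>)\<^sup>2)"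
      using sqi by simp
    also have "\<dots> < e\<^sup>2 / 2"
      using K[OF jk(1)] K[OF jk(2)] by simp
    finally have *: "(LINT \<zeta>|circ_m. (Im (u j \<zeta>) - Im (u k \<zeta>))\<^sup>2) < e\<^sup>2 / 2" .
    \<comment> \<open>From the square mean to the mean: expanding the nonnegative (e - |x|)^2 takes
      the place of the Cauchy-Schwarz inequality.\<close>
    have "(LINT \<zeta>|circ_m. \<bar>Im (u j \<zeta>) - Im (u k \<zeta>)\<bar>) \<le> (LINT \<zeta>|circ_m. e / 2 + (Im (u j \<zeta>) - Im (u k \<zeta>))\<^sup>2 / (2 * e))"
    proof (rule integral_mono)
      fix \<zeta>
      have "2 * e * \<bar>x\<bar> \<le> e * e + x\<^sup>2" for x
        using zero_le_power2[of "e - \<bar>x\<bar>"] by (simp add: power2_eq_square algebra_simps)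
      then have "2 * e * \<bar>Im (u j \<zeta>) - Im (u k \<zeta>)\<bar> \<le> e * e + (Im (u j \<zeta>) - Im (u k \<zeta>))\<^sup>2"
        .
      then show "\<bar>Im (u j \<zeta>) - Im (u k \<zeta>)\<bar> \<le> e / 2 + (Im (u j \<zeta>) - Im (u k \<zeta>))\<^sup>2 / (2 * e)"
        using \<open>0 < e\<close> by (simp add: field_simps)
    qed (use ii in auto)
    also have "\<dots> = e / 2 + (LINT \<zeta>|circ_m. (Im (u j \<zeta>) - Im (u k \<zeta>))\<^sup>2) / (2 * e)"
      using ii by simp
    also have "\<dots> < e / 2 + (e\<^sup>2 / 2) / (2 * e)"
      using * \<open>0 < e\<close> by (intro add_strict_left_mono divide_strict_right_mono) auto
    also have "\<dots> \<le> e"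
      using \<open>0 < e\<close> by (simp add: power2_eq_square)
    finally show ?thesis .
  qed
  then show ?thesis unfolding u_def by blast
qed

text \<open>\<open>conjugate_L1_bound\<close> is not homogeneous: its constant term 2 becomes 2 / l when it is applied
  to l times the tail of v.\<close>

lemma conjugate_tail_small:
  assumes v: "integrable circ_m v" "\<And>\<zeta>. 0 \<le> v \<zeta>" and pv: "\<And>c. 0 < c \<Longrightarrow> integrable circ_m (\<lambda>\<zeta>. phi (c * v \<zeta>))" and "0 < e"
  shows "\<exists>M\<ge>0. \<forall>r. \<bar>r\<bar> < 1 \<longrightarrow> (LINT \<zeta>|circ_m. \<bar>Im (herg (\<lambda>\<zeta>. max 0 (v \<zeta> - M)) (of_real r * \<zeta>))\<bar>) < e"
proof -
  \<comment> \<open>Since l e = 8, the final bound 2 * 1 + 2 * (1 + l * (e / 8)) is 6, which is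
    below l e.\<close>
  define l where "l = 8 / e"
  have l: "0 < l" using \<open>0 < e\<close> by (simp add: l_def)
  define t where "t n \<zeta> = max 0 (v \<zeta> - real n)" for n \<zeta>
  have [measurable]: "v \<in> borel_measurable circ_m" using v by simp
  have ti: "integrable circ_m (t n)" for n unfolding t_def using v by auto
  have t0: "0 \<le> t n \<zeta>" and tv: "t n \<zeta> \<le> v \<zeta>" for n \<zeta> using v(2)[of \<zeta>] by (auto simp: t_def)
  have tm[measurable]: "t n \<in> borel_measurable circ_m" for n using ti by simp
  have pt: "integrable circ_m (\<lambda>\<zeta>. phi (l * t n \<zeta>))" for n
  proof (rule Bochner_Integration.integrable_bound[OF pv[OF l]])
    show "AE \<zeta> in circ_m. norm (phi (l * t n \<zeta>)) \<le> norm (phi (l * v \<zeta>))"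
      using l t0 tv v by (intro AE_I2) (auto simp: phi_nonneg intro!: phi_mono)
  qed measurable
  have ev0: "eventually (\<lambda>n. t n \<zeta> = 0) sequentially" for \<zeta>
  proof -
    obtain n0 where n0: "v \<zeta> < real n0" using reals_Archimedean2 by blast
    show ?thesis
      using eventually_ge_at_top[of n0] by eventually_elim (use n0 in \<open>auto simp: t_def\<close>)
  qed
  have "(\<lambda>n. LINT \<zeta>|circ_m. t n \<zeta>) \<longlonglongrightarrow> (LINT \<zeta>|circ_m. 0)"
  proof (rule integral_dominated_convergence[OF _ _ v(1)])
    show "AE \<zeta> in circ_m. (\<lambda>n. t n \<zeta>) \<longlonglongrightarrow> 0"
      using ev0 by (intro AE_I2 tendsto_eventually) auto
  qed (use t0 tv in auto)
  then have 1: "(\<lambda>n. LINT \<zeta>|circ_m. t n \<zeta>) \<longlonglongrightarrow> 0" by simp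
  have "(\<lambda>n. LINT \<zeta>|circ_m. phi (l * t n \<zeta>)) \<longlonglongrightarrow> (LINT \<zeta>|circ_m. 0)"
  proof (rule integral_dominated_convergence[OF _ _ pv[OF l]])
    show "AE \<zeta> in circ_m. (\<lambda>n. phi (l * t n \<zeta>)) \<longlonglongrightarrow> 0"
    proof (intro AE_I2 tendsto_eventually)
      show "eventually (\<lambda>n. phi (l * t n \<zeta>) = 0) sequentially" for \<zeta>
        using ev0[of \<zeta>] by eventually_elim (simp add: phi_def)
    qed
    show "AE \<zeta> in circ_m. norm (phi (l * t n \<zeta>)) \<le> phi (l * v \<zeta>)" for n
      using l t0 tv v by (intro AE_I2) (auto simp: phi_nonneg intro!: phi_mono)
  qed auto
  then have 2: "(\<lambda>n. LINT \<zeta>|circ_m. phi (l * t n \<zeta>)) \<longlonglongrightarrow> 0" by simp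
  have "eventually (\<lambda>n. (LINT \<zeta>|circ_m. t n \<zeta>) < e / 8 \<and> (LINT \<zeta>|circ_m. phi (l * t n \<zeta>)) < 1) sequentially"
    using order_tendstoD(2)[OF 1, of "e / 8"] order_tendstoD(2)[OF 2, of 1] \<open>0 < e\<close>
    by (auto elim: eventually_elim2)
  then obtain n where n: "(LINT \<zeta>|circ_m. t n \<zeta>) < e / 8" "(LINT \<zeta>|circ_m. phi (l * t n \<zeta>)) < 1"
    by (auto simp: eventually_sequentially)
  have "(LINT \<zeta>|circ_m. \<bar>Im (herg (t n) (of_real r * \<zeta>))\<bar>) < e" if r: "\<bar>r\<bar> < 1" for r
  proof -
    have "l * (LINT \<zeta>|circ_m. \<bar>Im (herg (t n) (of_real r * \<zeta>))\<bar>)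
       = (LINT \<zeta>|circ_m. \<bar>Im (herg (\<lambda>\<zeta>. l * t n \<zeta>) (of_real r * \<zeta>))\<bar>)"
      using l by (simp add: herg_cmult abs_mult)
    also have "\<dots> \<le> 2 * (LINT \<zeta>|circ_m. phi (l * t n \<zeta>)) + 2 * (1 + (LINT \<zeta>|circ_m. l * t n \<zeta>))"
      using ti t0 l by (intro conjugate_L1_bound pt r) auto
    also have "\<dots> < 2 * 1 + 2 * (1 + l * (e / 8))"
      using n l by (simp add: add_strict_mono)
    also have "\<dots> \<le> l * e"
      using \<open>0 < e\<close> by (simp add: l_def)
    finally show ?thesis using l by simp
  qed
  then show ?thesis
    by (intro exI[of _ "real n"]) (auto simp: t_def[abs_def])
qed

text \<open>Cut v at a level M whose tail has small conjugate means on all circles at once; the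
  bounded part \<open>v1\<close> is Cauchy, and the tail \<open>v2\<close> enters once for each of
  the two radii.\<close>

lemma conjugate_Cauchy:
  assumes v: "integrable circ_m v" "\<And>\<zeta>. 0 \<le> v \<zeta>" and pv: "\<And>c. 0 < c \<Longrightarrow> integrable circ_m (\<lambda>\<zeta>. phi (c * v \<zeta>))" and "0 < e"
  shows "\<exists>K. \<forall>j\<ge>K. \<forall>k\<ge>K. (LINT \<zeta>|circ_m. \<bar>Im (herg v (of_real (radius j) * \<zeta>)) - Im (herg v (of_real (radius k) * \<zeta>))\<bar>) < e"
proof -
  obtain M where M: "0 \<le> M" "\<And>r. \<bar>r\<bar> < 1 \<Longrightarrow> (LINT \<zeta>|circ_m. \<bar>Im (herg (\<lambda>\<zeta>. max 0 (v \<zeta> - M)) (of_real r * \<zeta>))\<bar>) < e / 3"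
    using conjugate_tail_small[OF v pv, of "e / 3"] \<open>0 < e\<close> by auto
  define v1 where "v1 \<zeta> = min (v \<zeta>) M" for \<zeta>
  define v2 where "v2 \<zeta> = max 0 (v \<zeta> - M)" for \<zeta>
  have i: "integrable circ_m v1" "integrable circ_m v2"
    unfolding v1_def v2_def using v by auto
  have eq: "v = (\<lambda>\<zeta>. v1 \<zeta> + v2 \<zeta>)" by (auto simp: v1_def v2_def)
  have "\<exists>K. \<forall>j\<ge>K. \<forall>k\<ge>K. (LINT \<zeta>|circ_m. \<bar>Im (herg v1 (of_real (radius j) * \<zeta>)) - Im (herg v1 (of_real (radius k) * \<zeta>))\<bar>) < e / 3"
    using i(1) \<open>0 < e\<close> v(2) M(1) by (intro conjugate_Cauchy_bounded[of _ M]) (auto simp: v1_def)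
  then obtain K where K: "\<And>j k. j \<ge> K \<Longrightarrow> k \<ge> K \<Longrightarrow> (LINT \<zeta>|circ_m. \<bar>Im (herg v1 (of_real (radius j) * \<zeta>)) - Im (herg v1 (of_real (radius k) * \<zeta>))\<bar>) < e / 3"
    by blast
  have "(LINT \<zeta>|circ_m. \<bar>Im (herg v (of_real (radius j) * \<zeta>)) - Im (herg v (of_real (radius k) * \<zeta>))\<bar>) < e" if "j \<ge> K" "k \<ge> K" for j k
  proof -
    note ii = integrable_Im_herg_dilation[OF v(1) radius_bounds(3)]
      integrable_Im_herg_dilation[OF i(1) radius_bounds(3)] integrable_Im_herg_dilation[OF i(2) radius_bounds(3)]
    have "(LINT \<zeta>|circ_m. \<bar>Im (herg v (of_real (radius j) * \<zeta>)) - Im (herg v (of_real (radius k) * \<zeta>))\<bar>)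
      \<le> (LINT \<zeta>|circ_m. \<bar>Im (herg v1 (of_real (radius j) * \<zeta>)) - Im (herg v1 (of_real (radius k) * \<zeta>))\<bar>
           + \<bar>Im (herg v2 (of_real (radius j) * \<zeta>))\<bar> + \<bar>Im (herg v2 (of_real (radius k) * \<zeta>))\<bar>)"
    proof (rule integral_mono_AE)
      show "AE \<zeta> in circ_m. \<bar>Im (herg v (of_real (radius j) * \<zeta>)) - Im (herg v (of_real (radius k) * \<zeta>))\<bar>
        \<le> \<bar>Im (herg v1 (of_real (radius j) * \<zeta>)) - Im (herg v1 (of_real (radius k) * \<zeta>))\<bar>
           + \<bar>Im (herg v2 (of_real (radius j) * \<zeta>))\<bar> + \<bar>Im (herg v2 (of_real (radius k) * \<zeta>))\<bar>"
        using AE_circ_m_sphere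
      proof eventually_elim
        case (elim \<zeta>)
        have "herg v (of_real (radius k) * \<zeta>) = herg v1 (of_real (radius k) * \<zeta>) + herg v2 (of_real (radius k) * \<zeta>)" for k
          using herg_add[OF i norm_dilate_less[OF elim radius_bounds(3)], of k] eq by simp
        then show ?case by simp
      qed
    qed (use ii in auto)
    also have "\<dots> = (LINT \<zeta>|circ_m. \<bar>Im (herg v1 (of_real (radius j) * \<zeta>)) - Im (herg v1 (of_real (radius k) * \<zeta>))\<bar>)
           + (LINT \<zeta>|circ_m. \<bar>Im (herg v2 (of_real (radius j) * \<zeta>))\<bar>) + (LINT \<zeta>|circ_m. \<bar>Im (herg v2 (of_real (radius k) * \<zeta>))\<bar>)"
      using ii by simp
    also have "\<dots> < e / 3 + e / 3 + e / 3"
      using K[OF that] M(2)[OF radius_bounds(3), of j] M(2)[OF radius_bounds(3), of k] unfolding v2_def[abs_def]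
      by (intro add_strict_mono) auto
    finally show ?thesis by simp
  qed
  then show ?thesis by blast
qed

text \<open>The dilations \<open>f k\<close> of Im H converge in L^1 to some w. By the Poisson
  formula, the Poisson integral of \<open>f k\<close> at z is Im H at radius k times z; now let k
  tend to infinity on both sides.\<close>

lemma conjugate_eq_Poisson_integral:
  assumes v: "integrable circ_m v" "\<And>\<zeta>. 0 \<le> v \<zeta>" and pv: "\<And>c. 0 < c \<Longrightarrow> integrable circ_m (\<lambda>\<zeta>. phi (c * v \<zeta>))"
  obtains w where "integrable circ_m w" "\<And>z. norm z < 1 \<Longrightarrow> Im (herg v z) = Re (herg w z)"
proof -
  define f where "f k \<zeta> = Im (herg v (of_real (radius k) * \<zeta>))" for k \<zeta>
  have fi: "integrable circ_m (f k)" for k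
    unfolding f_def by (intro integrable_Im_herg_dilation v radius_bounds)
  have fm[measurable]: "f k \<in> borel_measurable circ_m" for k using fi by simp
  have cau: "\<exists>K. \<forall>j\<ge>K. \<forall>k\<ge>K. (LINT \<zeta>|circ_m. norm (f j \<zeta> - f k \<zeta>)) < e" if "0 < e" for e
    unfolding f_def real_norm_def by (rule conjugate_Cauchy[OF v pv that])
  obtain \<sigma> where \<sigma>: "strict_mono \<sigma>" "AE \<zeta> in circ_m. Cauchy (\<lambda>i. f (\<sigma> i) \<zeta>)"
    using cauchy_L1_AE_cauchy_subseq[of circ_m f] fi cau by blast
  define w where "w \<zeta> = lim (\<lambda>i. f (\<sigma> i) \<zeta>)" for \<zeta>
  have [measurable]: "w \<in> borel_measurable circ_m"
    unfolding w_def by measurable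
  have lim: "AE \<zeta> in circ_m. (\<lambda>i. f (\<sigma> i) \<zeta>) \<longlonglongrightarrow> w \<zeta>"
    using \<sigma>(2) by eventually_elim (simp add: w_def Cauchy_convergent_iff convergent_LIMSEQ_iff)
  \<comment> \<open>The pointwise limit of the subsequence is the L^1 limit of the whole sequence:
    fix j, apply Fatou's lemma along the subsequence and use the Cauchy bound.\<close>
  have near: "\<exists>K. \<forall>j\<ge>K. (\<integral>\<^sup>+\<zeta>. ennreal \<bar>f j \<zeta> - w \<zeta>\<bar> \<partial>circ_m) \<le> ennreal e" if "0 < e" for e
  proof -
    obtain K where K: "\<And>j k. j \<ge> K \<Longrightarrow> k \<ge> K \<Longrightarrow> (LINT \<zeta>|circ_m. norm (f j \<zeta> - f k \<zeta>)) < e"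
      using cau[OF \<open>0 < e\<close>] by blast
    have "(\<integral>\<^sup>+\<zeta>. ennreal \<bar>f j \<zeta> - w \<zeta>\<bar> \<partial>circ_m) \<le> ennreal e" if "j \<ge> K" for j
    proof -
      have "(\<integral>\<^sup>+\<zeta>. ennreal \<bar>f j \<zeta> - w \<zeta>\<bar> \<partial>circ_m) = (\<integral>\<^sup>+\<zeta>. liminf (\<lambda>i. ennreal \<bar>f j \<zeta> - f (\<sigma> i) \<zeta>\<bar>) \<partial>circ_m)"
      proof (rule nn_integral_cong_AE)
        show "AE \<zeta> in circ_m. ennreal \<bar>f j \<zeta> - w \<zeta>\<bar> = liminf (\<lambda>i. ennreal \<bar>f j \<zeta> - f (\<sigma> i) \<zeta>\<bar>)"
          using lim
        proof eventually_elim
          case (elim \<zeta>)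
          have "(\<lambda>i. ennreal \<bar>f j \<zeta> - f (\<sigma> i) \<zeta>\<bar>) \<longlonglongrightarrow> ennreal \<bar>f j \<zeta> - w \<zeta>\<bar>"
            by (intro tendsto_intros elim)
          then show ?case by (rule lim_imp_Liminf[OF sequentially_bot, symmetric])
        qed
      qed
      also have "\<dots> \<le> liminf (\<lambda>i. \<integral>\<^sup>+\<zeta>. ennreal \<bar>f j \<zeta> - f (\<sigma> i) \<zeta>\<bar> \<partial>circ_m)"
        by (rule nn_integral_liminf) measurable
      also have "\<dots> \<le> liminf (\<lambda>i. ennreal e)"
      proof (rule Liminf_mono)
        show "eventually (\<lambda>i. (\<integral>\<^sup>+\<zeta>. ennreal \<bar>f j \<zeta> - f (\<sigma> i) \<zeta>\<bar> \<partial>circ_m) \<le> ennreal e) sequentially"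
          using eventually_ge_at_top[of K]
        proof eventually_elim
          case (elim i)
          then have "K \<le> \<sigma> i" using seq_suble[OF \<sigma>(1), of i] by simp
          then have "(LINT \<zeta>|circ_m. \<bar>f j \<zeta> - f (\<sigma> i) \<zeta>\<bar>) < e" using K[OF that] by simp
          moreover have "(\<integral>\<^sup>+\<zeta>. ennreal \<bar>f j \<zeta> - f (\<sigma> i) \<zeta>\<bar> \<partial>circ_m) = ennreal (LINT \<zeta>|circ_m. \<bar>f j \<zeta> - f (\<sigma> i) \<zeta>\<bar>)"
            using fi by (intro nn_integral_eq_integral) auto
          ultimately show ?case by (simp add: ennreal_leI)
        qed
      qed
      finally show ?thesis by (simp add: Liminf_const)
    qed
    then show ?thesis by blast
  qed
  have fwi: "eventually (\<lambda>j. integrable circ_m (\<lambda>\<zeta>. f j \<zeta> - w \<zeta>)) sequentially"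
  proof -
    obtain K where K: "\<And>j. j \<ge> K \<Longrightarrow> (\<integral>\<^sup>+\<zeta>. ennreal \<bar>f j \<zeta> - w \<zeta>\<bar> \<partial>circ_m) \<le> ennreal 1"
      using near[of 1] by auto
    show ?thesis
      using eventually_ge_at_top[of K]
    proof eventually_elim
      case (elim j)
      then show ?case using K[OF elim]
        by (intro integrableI_bounded) (auto simp: le_less_trans)
    qed
  qed
  then obtain j0 where "integrable circ_m (\<lambda>\<zeta>. f j0 \<zeta> - w \<zeta>)"
    by (auto simp: eventually_sequentially)
  from Bochner_Integration.integrable_diff[OF fi[of j0] this] have wi: "integrable circ_m w" by simp
  have l1: "(\<lambda>j. LINT \<zeta>|circ_m. \<bar>f j \<zeta> - w \<zeta>\<bar>) \<longlonglongrightarrow> 0"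
  proof (rule LIMSEQ_I)
    fix e :: real assume "0 < e"
    then obtain K where K: "\<And>j. j \<ge> K \<Longrightarrow> (\<integral>\<^sup>+\<zeta>. ennreal \<bar>f j \<zeta> - w \<zeta>\<bar> \<partial>circ_m) \<le> ennreal (e / 2)"
      using near[of "e / 2"] by auto
    have "norm ((LINT \<zeta>|circ_m. \<bar>f j \<zeta> - w \<zeta>\<bar>) - 0) < e" if "j \<ge> K" for j
    proof -
      have "(\<integral>\<^sup>+\<zeta>. ennreal \<bar>f j \<zeta> - w \<zeta>\<bar> \<partial>circ_m) = ennreal (LINT \<zeta>|circ_m. \<bar>f j \<zeta> - w \<zeta>\<bar>)"
        using fi wi by (intro nn_integral_eq_integral) auto
      then have "(LINT \<zeta>|circ_m. \<bar>f j \<zeta> - w \<zeta>\<bar>) \<le> e / 2"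
        using K[OF that] \<open>0 < e\<close> by simp
      then show ?thesis using \<open>0 < e\<close> by simp
    qed
    then show "\<exists>K. \<forall>j\<ge>K. norm ((LINT \<zeta>|circ_m. \<bar>f j \<zeta> - w \<zeta>\<bar>) - 0) < e" by blast
  qed
  have "Im (herg v z) = Re (herg w z)" if z: "norm z < 1" for z
  proof -
    note h = herg_holomorphic[OF v(1)]
    have rep: "Im (herg v (of_real (radius k) * z)) = Re (herg (f k) z)" for k
    proof -
      have c: "continuous_on (sphere 0 1) (\<lambda>\<zeta>. herg v (of_real (radius k) * \<zeta>) * of_real (pois z \<zeta>))"
        by (intro continuous_intros dilation_continuous h radius_bounds pois_continuous z)
      have "herg v (of_real (radius k) * z) = (LINT \<zeta>|circ_m. herg v (of_real (radius k) * \<zeta>) * of_real (pois z \<zeta>))"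
        by (rule pois_reproduces[symmetric]) (intro holomorphic_dilation h radius_bounds z)+
      then have "Im (herg v (of_real (radius k) * z)) = (LINT \<zeta>|circ_m. Im (herg v (of_real (radius k) * \<zeta>) * of_real (pois z \<zeta>)))"
        using integral_Im[OF integrable_circ_m_continuous[OF c]] by simp
      also have "\<dots> = Re (herg (f k) z)"
        unfolding Re_herg(1)[OF fi z] by (intro Bochner_Integration.integral_cong) (auto simp: f_def)
      finally show ?thesis .
    qed
    have "(\<lambda>k. herg v (of_real (radius k) * z)) \<longlonglongrightarrow> herg v (of_real 1 * z)"
    proof (rule continuous_on_tendsto_compose[OF holomorphic_on_imp_continuous_on[OF h]])
      have "radius \<longlonglongrightarrow> 1"
        using radius_tendsto by (simp add: filterlim_at)
      then show "(\<lambda>k. of_real (radius k) * z) \<longlonglongrightarrow> of_real 1 * z"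
        by (intro tendsto_intros)
      have "norm (of_real (radius k) * z) < 1" for k
        using radius_bounds[of k] z by (simp add: norm_mult) (smt (verit) mult_left_le_one_le norm_ge_zero)
      then show "\<forall>\<^sub>F k in sequentially. of_real (radius k) * z \<in> ball 0 1" by simp
    qed (use z in simp)
    then have 1: "(\<lambda>k. Re (herg (f k) z)) \<longlonglongrightarrow> Im (herg v z)"
      using tendsto_Im by (fastforce simp: rep)
    \<comment> \<open>At a fixed z the kernel is bounded by 2 / (1 - norm z), so L^1 convergence on
      the circle suffices.\<close>
    have "(\<lambda>k. Re (herg (f k) z) - Re (herg w z)) \<longlonglongrightarrow> 0"
    proof (rule Lim_null_comparison)
      show "(\<lambda>k. 2 / (1 - norm z) * (LINT \<zeta>|circ_m. \<bar>f k \<zeta> - w \<zeta>\<bar>)) \<longlonglongrightarrow> 0"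
        using tendsto_mult_right_zero[OF l1] .
      have "norm (Re (herg (f k) z) - Re (herg w z)) \<le> 2 / (1 - norm z) * (LINT \<zeta>|circ_m. \<bar>f k \<zeta> - w \<zeta>\<bar>)" for k
      proof -
        have fw: "integrable circ_m (\<lambda>\<zeta>. f k \<zeta> - w \<zeta>)" using fi wi by simp
        have "norm (Re (herg (f k) z) - Re (herg w z)) = \<bar>Re (herg (\<lambda>\<zeta>. f k \<zeta> - w \<zeta>) z)\<bar>"
          by (simp add: herg_diff[OF fi wi z])
        also have "\<dots> \<le> norm (herg (\<lambda>\<zeta>. f k \<zeta> - w \<zeta>) z)" by (rule abs_Re_le_cmod)
        also have "\<dots> \<le> (LINT \<zeta>|circ_m. norm (hk z \<zeta> * of_real (f k \<zeta> - w \<zeta>)))"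
          unfolding herg_def by (rule integral_norm_bound)
        also have "\<dots> \<le> (LINT \<zeta>|circ_m. 2 / (1 - norm z) * \<bar>f k \<zeta> - w \<zeta>\<bar>)"
        proof (rule integral_mono_AE)
          show "AE \<zeta> in circ_m. norm (hk z \<zeta> * of_real (f k \<zeta> - w \<zeta>)) \<le> 2 / (1 - norm z) * \<bar>f k \<zeta> - w \<zeta>\<bar>"
            using AE_circ_m_sphere
          proof eventually_elim
            case (elim \<zeta>)
            then show ?case
              unfolding norm_mult norm_of_real by (intro mult_right_mono norm_herglotz_kernel_le z) auto
          qed
          show "integrable circ_m (\<lambda>\<zeta>. norm (hk z \<zeta> * of_real (f k \<zeta> - w \<zeta>)))"
            using herg_integrable[OF fw z] by (rule integrable_norm)
        qed (use fw in auto)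
        finally show ?thesis by simp
      qed
      then show "\<forall>\<^sub>F k in sequentially. norm (Re (herg (f k) z) - Re (herg w z)) \<le> 2 / (1 - norm z) * (LINT \<zeta>|circ_m. \<bar>f k \<zeta> - w \<zeta>\<bar>)"
        by simp
    qed
    then have "(\<lambda>k. Re (herg (f k) z)) \<longlonglongrightarrow> Re (herg w z)"
      by (rule LIM_zero_cancel)
    with 1 show ?thesis by (rule LIMSEQ_unique)
  qed
  with wi show ?thesis by (rule that)
qed

text \<open>With C = max 1 c, ln (1 + C x) is at most ln (2 C) plus the positive part of ln x. Where
  this positive part stands alone it is absorbed into x, hence the + 1. Thus L log L survives
  scaling, and \<open>conjugate_tail_small\<close> uses arbitrarily large c.\<close>

lemma phi_le_LlogL:
  assumes "0 \<le> x" "0 < c"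
  shows "phi (c * x) \<le> ln (2 * max 1 c) + (max 1 c * ln (2 * max 1 c) + 1) * x + max 1 c * (x * max 0 (ln x))"
proof -
  define C where "C = max 1 c"
  have C: "1 \<le> C" "c \<le> C" by (auto simp: C_def)
  have "phi (c * x) \<le> phi (C * x)"
    using assms C by (intro phi_mono mult_right_mono) auto
  also have "\<dots> \<le> (1 + C * x) * (ln (2 * C) + max 0 (ln x))"
  proof (unfold phi_def, rule mult_left_mono)
    show "ln (1 + C * x) \<le> ln (2 * C) + max 0 (ln x)"
    proof (cases "x \<ge> 1")
      case True
      have "1 \<le> C * x" using mult_mono[of 1 C 1 x] True C by simp
      then have "ln (1 + C * x) \<le> ln ((2 * C) * x)"
        using C True by (subst ln_le_cancel_iff) auto
      also have "\<dots> = ln (2 * C) + ln x" using C True by (simp add: ln_mult)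
      finally show ?thesis by simp
    next
      case False
      have "C * x \<le> C" using False C assms by (simp add: mult_left_le)
      then have "1 + C * x \<le> 2 * C" using C by linarith
      then have "ln (1 + C * x) \<le> ln (2 * C)"
        using C assms by (intro ln_mono) (auto intro: add_pos_nonneg)
      then show ?thesis by simp
    qed
    show "0 \<le> 1 + C * x" using C assms by simp
  qed
  also have "\<dots> = ln (2 * C) + C * ln (2 * C) * x + max 0 (ln x) + C * (x * max 0 (ln x))"
    by (simp add: algebra_simps)
  finally have *: "phi (c * x) \<le> ln (2 * C) + C * ln (2 * C) * x + max 0 (ln x) + C * (x * max 0 (ln x))" .
  have "max 0 (ln x) \<le> x"
  proof (cases "x = 0")
    case False
    then show ?thesis using assms ln_le_minus_one[of x] by simp
  qed simp
  with * show ?thesis unfolding C_def[symmetric] distrib_right mult_1 by linarith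
qed

lemma LlogL_imp_phi_integrable:
  assumes v: "integrable circ_m v" "\<And>\<zeta>. 0 \<le> v \<zeta>" and "LlogL v" "0 < c"
  shows "integrable circ_m (\<lambda>\<zeta>. phi (c * v \<zeta>))"
proof -
  have [measurable]: "v \<in> borel_measurable circ_m" using v by simp
  have "integrable circ_m (\<lambda>\<zeta>. v \<zeta> * max 0 (ln (v \<zeta>)))"
    using \<open>LlogL v\<close> v(2) by (intro integrableI_bounded) (auto simp: LlogL_def abs_mult)
  then have "integrable circ_m (\<lambda>\<zeta>. ln (2 * max 1 c) + (max 1 c * ln (2 * max 1 c) + 1) * v \<zeta> + max 1 c * (v \<zeta> * max 0 (ln (v \<zeta>))))"
    using v by auto
  then show ?thesis
  proof (rule Bochner_Integration.integrable_bound)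
    show "AE \<zeta> in circ_m. norm (phi (c * v \<zeta>)) \<le> norm (ln (2 * max 1 c) + (max 1 c * ln (2 * max 1 c) + 1) * v \<zeta> + max 1 c * (v \<zeta> * max 0 (ln (v \<zeta>))))"
    proof (rule AE_I2)
      fix \<zeta>
      show "norm (phi (c * v \<zeta>)) \<le> norm (ln (2 * max 1 c) + (max 1 c * ln (2 * max 1 c) + 1) * v \<zeta> + max 1 c * (v \<zeta> * max 0 (ln (v \<zeta>))))"
        using phi_le_LlogL[OF v(2)[of \<zeta>] \<open>0 < c\<close>] phi_nonneg[of "c * v \<zeta>"] v(2)[of \<zeta>] \<open>0 < c\<close> by simp
    qed
  qed measurable
qed

section \<open>The Smirnov class\<close>

text \<open>Here |F| is exp of minus the Poisson integral of w, so |F h| is exp of minus the Poisson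
  integral of w + |w|, which is at most 1.\<close>

lemma smirnov_exp_herg:
  assumes v: "integrable circ_m v" and w: "integrable circ_m w" "\<And>z. norm z < 1 \<Longrightarrow> Im (herg v z) = Re (herg w z)"
    and F: "\<And>z. norm z < 1 \<Longrightarrow> F z = exp (\<i> * herg v z)"
  shows "smirnov F"
proof -
  define u where "u \<zeta> = - \<bar>w \<zeta>\<bar>" for \<zeta>
  have u: "integrable circ_m u" unfolding u_def using w by simp
  define h where "h z = exp (herg u z)" for z
  define g where "g z = exp (\<i> * herg v z) * h z" for z
  have u0: "Re (herg u z) \<le> 0" if "norm z < 1" for z
    using Re_herg_mono[of u "\<lambda>_. 0" z] herg_const[OF that, of 0] u that by (auto simp: u_def)
  have uw: "- Re (herg w z) + Re (herg u z) \<le> 0" if "norm z < 1" for z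
  proof -
    have "Re (herg u z) \<le> Re (herg w z)"
      using u w that by (intro Re_herg_mono) (auto simp: u_def)
    then show ?thesis by simp
  qed
  have "Hinf h"
    unfolding Hinf_def h_def bounded_iff
    by (auto intro!: holomorphic_intros herg_holomorphic u exI[of _ 1] u0)
  moreover have "Hinf g"
    unfolding Hinf_def g_def h_def bounded_iff exp_add[symmetric]
    using uw by (auto intro!: holomorphic_intros herg_holomorphic u v exI[of _ 1] simp: w)
  moreover have "outer h"
    unfolding outer_def h_def herg_def hk_def using u by (intro exI[of _ 1] exI[of _ u]) auto
  moreover have "F z = g z / h z" if "z \<in> ball 0 1" for z
    using that F[of z] by (simp add: g_def h_def)
  ultimately show ?thesis
    unfolding smirnov_def by blast
qed

text \<open>Both Re H and Im H are Poisson integrals of integrable functions, so F tends radially to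
  exp (i v - w) almost everywhere; this is real where sin v = 0.\<close>

lemma exp_herg_radial_limit_real:
  assumes v: "integrable circ_m v" and w: "integrable circ_m w" "\<And>z. norm z < 1 \<Longrightarrow> Im (herg v z) = Re (herg w z)"
    and F: "\<And>z. norm z < 1 \<Longrightarrow> F z = exp (\<i> * herg v z)"
    and sin: "AE \<zeta> in circ_m. sin (v \<zeta>) = 0"
  shows "AE \<zeta> in circ_m. \<exists>L::real. ((\<lambda>r::real. F (of_real r * \<zeta>)) \<longlongrightarrow> of_real L) (at_left 1)"
  using Fatou_radial_limit[OF v] Fatou_radial_limit[OF w(1)] sin AE_circ_m_sphere
proof eventually_elim
  case (elim \<zeta>)
  have ev: "eventually (\<lambda>r. r \<in> {0<..<1}) (at_left (1::real))"
    by (intro eventually_at_left_real) auto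
  have "((\<lambda>r. Complex (Re (herg v (of_real r * \<zeta>))) (Re (herg w (of_real r * \<zeta>)))) \<longlongrightarrow> Complex (v \<zeta>) (w \<zeta>)) (at_left 1)"
    by (intro tendsto_Complex elim)
  then have "((\<lambda>r. exp (\<i> * Complex (Re (herg v (of_real r * \<zeta>))) (Re (herg w (of_real r * \<zeta>)))))
      \<longlongrightarrow> exp (\<i> * Complex (v \<zeta>) (w \<zeta>))) (at_left 1)"
    by (rule tendsto_exp[OF tendsto_mult[OF tendsto_const]])
  moreover have "eventually (\<lambda>r. exp (\<i> * Complex (Re (herg v (of_real r * \<zeta>))) (Re (herg w (of_real r * \<zeta>)))) = F (of_real r * \<zeta>)) (at_left 1)"
    using ev
  proof eventually_elim
    case (elim r)
    then have nz: "norm (of_real r * \<zeta>) < 1"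
      using \<open>norm \<zeta> = 1\<close> by (simp add: norm_mult)
    have "Complex (Re (herg v (of_real r * \<zeta>))) (Re (herg w (of_real r * \<zeta>))) = herg v (of_real r * \<zeta>)"
      using w(2)[OF nz] by (simp add: complex_eq_iff)
    then show ?case using F[OF nz] by simp
  qed
  ultimately have "((\<lambda>r. F (of_real r * \<zeta>)) \<longlongrightarrow> exp (\<i> * Complex (v \<zeta>) (w \<zeta>))) (at_left 1)"
    by (rule Lim_transform_eventually)
  moreover have "exp (\<i> * Complex (v \<zeta>) (w \<zeta>)) = of_real (exp (- w \<zeta>) * cos (v \<zeta>))"
    using elim by (simp add: complex_eq_iff Re_exp Im_exp)
  ultimately show ?case by metis
qed

text \<open>As |F| = exp (- Im H), the quotient g / h controls only the negative part of Im H. The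
  positive part has the same circle mean, because H is real at the origin and so the means of Im H
  vanish.\<close>

lemma smirnov_imp_conjugate_bounded:
  assumes v: "integrable circ_m v" and F: "\<And>z. norm z < 1 \<Longrightarrow> F z = exp (\<i> * herg v z)" and "smirnov F"
  shows "\<exists>C. \<forall>r. \<bar>r\<bar> < 1 \<longrightarrow> (LINT \<zeta>|circ_m. \<bar>Im (herg v (of_real r * \<zeta>))\<bar>) \<le> C"
proof -
  obtain g h where g: "Hinf g" and h: "outer h" and gh: "\<And>z. z \<in> ball 0 1 \<Longrightarrow> F z = g z / h z"
    using \<open>smirnov F\<close> by (auto simp: smirnov_def)
  obtain c u where c: "norm c = 1" and u: "integrable circ_m u" and hu: "\<And>z. z \<in> ball 0 1 \<Longrightarrow> h z = c * exp (herg u z)"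
    using h unfolding outer_def herg_def hk_def by blast
  obtain B0 where B0: "\<And>z. z \<in> ball 0 1 \<Longrightarrow> norm (g z) \<le> B0"
    using g unfolding Hinf_def bounded_iff by (metis imageI)
  \<comment> \<open>At least 1, so that ln B is nonnegative and \<open>key\<close> also holds where
    Im H is positive.\<close>
  define B where "B = max 1 B0"
  have B: "1 \<le> B" "\<And>z. z \<in> ball 0 1 \<Longrightarrow> norm (g z) \<le> B"
    using B0 by (force simp: B_def)+
  define U where "U \<zeta> = \<bar>u \<zeta>\<bar>" for \<zeta>
  have U: "integrable circ_m U" unfolding U_def using u by simp
  \<comment> \<open>|x| is x plus twice its negative part, and the negative part of Im H is at most
    ln B plus the Poisson integral of |u|.\<close>
  have key: "\<bar>Im (herg v z)\<bar> \<le> Im (herg v z) + 2 * ln B + 2 * Re (herg U z)" if z: "norm z < 1" for z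
  proof -
    have "norm (F z) * norm (h z) = norm (g z)"
      using gh[of z] hu[of z] c z by (auto simp: norm_divide)
    then have "exp (- Im (herg v z)) * exp (Re (herg u z)) \<le> B"
      using B(2)[of z] F[OF z] hu[of z] c z by (simp add: norm_mult)
    then have "exp (- Im (herg v z) + Re (herg u z)) \<le> B"
      by (simp only: exp_add)
    then have "- Im (herg v z) + Re (herg u z) \<le> ln B"
      using B(1) by (subst ln_ge_iff) auto
    then have 1: "- Im (herg v z) \<le> ln B - Re (herg u z)" by simp
    have "Re (herg (\<lambda>\<zeta>. - u \<zeta>) z) \<le> Re (herg U z)"
      using u U z by (intro Re_herg_mono) (auto simp: U_def)
    then have 2: "- Re (herg u z) \<le> Re (herg U z)" by (simp add: herg_minus)
    have 3: "0 \<le> Re (herg U z)" "0 \<le> ln B"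
      using B U z by (auto intro!: Re_herg_nonneg simp: U_def)
    show ?thesis using 1 2 3 by linarith
  qed
  have "(LINT \<zeta>|circ_m. \<bar>Im (herg v (of_real r * \<zeta>))\<bar>) \<le> 2 * ln B + 2 * (LINT \<zeta>|circ_m. U \<zeta>)" if r: "\<bar>r\<bar> < 1" for r
  proof -
    note vi = Re_herg_dilation_mean(2)[OF v r] and Ui = Re_herg_dilation_mean[OF U r]
    have "(LINT \<zeta>|circ_m. \<bar>Im (herg v (of_real r * \<zeta>))\<bar>)
      \<le> (LINT \<zeta>|circ_m. Im (herg v (of_real r * \<zeta>)) + 2 * ln B + 2 * Re (herg U (of_real r * \<zeta>)))"
    proof (rule integral_mono_AE)
      show "AE \<zeta> in circ_m. \<bar>Im (herg v (of_real r * \<zeta>))\<bar> \<le> Im (herg v (of_real r * \<zeta>)) + 2 * ln B + 2 * Re (herg U (of_real r * \<zeta>))"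
        using AE_circ_m_sphere by eventually_elim (intro key norm_dilate_less r)
    qed (use vi Ui in auto)
    also have "\<dots> = (LINT \<zeta>|circ_m. Im (herg v (of_real r * \<zeta>))) + 2 * ln B + 2 * (LINT \<zeta>|circ_m. U \<zeta>)"
      using vi Ui by simp
    also have "(LINT \<zeta>|circ_m. Im (herg v (of_real r * \<zeta>))) = 0"
      using dilation_mean_value[OF herg_holomorphic[OF v] r] integral_Im[OF vi] herg_0[OF v] by simp
    finally show ?thesis by simp
  qed
  then show ?thesis by blast
qed

text \<open>\<open>phi (v \<zeta>)\<close> dominates the L log L integrand and is almost everywhere
  the limit of \<open>phi (u k \<zeta>)\<close>, whose integrals
  \<open>phi_mean_le_conjugate\<close> bounds uniformly.\<close>

lemma conjugate_bounded_imp_LlogL: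
  assumes v: "integrable circ_m v" "\<And>\<zeta>. 0 \<le> v \<zeta>"
    and C: "\<And>r. \<bar>r\<bar> < 1 \<Longrightarrow> (LINT \<zeta>|circ_m. \<bar>Im (herg v (of_real r * \<zeta>))\<bar>) \<le> C"
  shows "LlogL v"
proof -
  define u where "u k \<zeta> = Re (herg v (of_real (radius k) * \<zeta>))" for k \<zeta>
  have [measurable]: "v \<in> borel_measurable circ_m" "u k \<in> borel_measurable circ_m" for k
    using v Re_herg_dilation_mean(2)[OF v(1) radius_bounds(3)] by (auto simp: u_def[abs_def])
  define A where "A = phi (LINT \<zeta>|circ_m. v \<zeta>) + pi / 2 * C"
  have "(\<integral>\<^sup>+\<zeta>. ennreal (\<bar>v \<zeta>\<bar> * max 0 (ln \<bar>v \<zeta>\<bar>)) \<partial>circ_m) \<le> (\<integral>\<^sup>+\<zeta>. ennreal (phi (v \<zeta>)) \<partial>circ_m)"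
  proof (rule nn_integral_mono)
    fix \<zeta>
    have "v \<zeta> * max 0 (ln (v \<zeta>)) \<le> (1 + v \<zeta>) * ln (1 + v \<zeta>)"
    proof (cases "v \<zeta> = 0")
      case False
      then show ?thesis using v(2)[of \<zeta>] by (intro mult_mono) auto
    qed simp
    then show "ennreal (\<bar>v \<zeta>\<bar> * max 0 (ln \<bar>v \<zeta>\<bar>)) \<le> ennreal (phi (v \<zeta>))"
      using v(2)[of \<zeta>] by (intro ennreal_leI) (simp add: phi_def)
  qed
  also have "\<dots> = (\<integral>\<^sup>+\<zeta>. liminf (\<lambda>k. ennreal (phi (u k \<zeta>))) \<partial>circ_m)"
  proof (rule nn_integral_cong_AE)
    show "AE \<zeta> in circ_m. ennreal (phi (v \<zeta>)) = liminf (\<lambda>k. ennreal (phi (u k \<zeta>)))"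
      using Fatou_radial_limit[OF v(1)]
    proof eventually_elim
      case (elim \<zeta>)
      have "(\<lambda>k. u k \<zeta>) \<longlonglongrightarrow> v \<zeta>"
        unfolding u_def by (rule filterlim_compose[OF elim radius_tendsto])
      then have "(\<lambda>k. ennreal (phi (u k \<zeta>))) \<longlonglongrightarrow> ennreal (phi (v \<zeta>))"
        unfolding phi_def using v(2)[of \<zeta>] by (intro tendsto_intros) auto
      then show ?case by (rule lim_imp_Liminf[OF sequentially_bot, symmetric])
    qed
  qed
  also have "\<dots> \<le> liminf (\<lambda>k. \<integral>\<^sup>+\<zeta>. ennreal (phi (u k \<zeta>)) \<partial>circ_m)"
    by (rule nn_integral_liminf) measurable
  also have "\<dots> \<le> liminf (\<lambda>k. ennreal A)"
  proof (rule Liminf_mono, rule always_eventually, rule allI)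
    fix k
    have "(\<integral>\<^sup>+\<zeta>. ennreal (phi (u k \<zeta>)) \<partial>circ_m)
      \<le> ennreal (phi (LINT \<zeta>|circ_m. v \<zeta>) + pi / 2 * (LINT \<zeta>|circ_m. \<bar>Im (herg v (of_real (radius k) * \<zeta>))\<bar>))"
      unfolding u_def by (rule phi_mean_le_conjugate[OF v radius_bounds(3)])
    also have "\<dots> \<le> ennreal A"
      unfolding A_def by (intro ennreal_leI add_left_mono mult_left_mono C radius_bounds) auto
    finally show "(\<integral>\<^sup>+\<zeta>. ennreal (phi (u k \<zeta>)) \<partial>circ_m) \<le> ennreal A" .
  qed
  also have "\<dots> < \<infinity>" by (simp add: Liminf_const)
  finally show ?thesis by (simp add: LlogL_def)
qed

text \<open>Isolates what is used of the sets E n: v is nonnegative, integrable, and has values in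
  pi * Z, the last encoded by the vanishing of sin.\<close>

theorem Rplus_exp_herg_iff:
  assumes v: "integrable circ_m v" "\<And>\<zeta>. 0 \<le> v \<zeta>" and sin: "AE \<zeta> in circ_m. sin (v \<zeta>) = 0"
    and F: "\<And>z. norm z < 1 \<Longrightarrow> F z = exp (\<i> * herg v z)"
  shows "Rplus F \<longleftrightarrow> LlogL v"
proof
  assume "Rplus F"
  then have "smirnov F" by (simp add: Rplus_def)
  then show "LlogL v"
    using smirnov_imp_conjugate_bounded[OF v(1) F] conjugate_bounded_imp_LlogL[OF v] by blast
next
  assume "LlogL v"
  then obtain w where w: "integrable circ_m w" "\<And>z. norm z < 1 \<Longrightarrow> Im (herg v z) = Re (herg w z)"
    using conjugate_eq_Poisson_integral[OF v LlogL_imp_phi_integrable[OF v]] by blast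
  show "Rplus F"
    unfolding Rplus_def using smirnov_exp_herg[OF v(1) w F] exp_herg_radial_limit_real[OF v(1) w F sin] by blast
qed

section \<open>The infinite product\<close>

text \<open>The function sin y - y cos y increases from 0, so y cos y \<le> sin y at y = t / 2.
  Doubling the angle gives sin t \<ge> t cos^2 (t / 2), and cos^2 is at least 1 / 2 up to pi /
  4.\<close>

lemma sin_ge_half:
  fixes t :: real assumes "0 \<le> t" "t \<le> pi / 2" shows "t / 2 \<le> sin t"
proof -
  let ?f = "\<lambda>y::real. sin y - y * cos y"
  have "?f 0 \<le> ?f (t / 2)"
  proof (rule DERIV_nonneg_imp_nondecreasing[where f = ?f and a = 0 and b = "t / 2"])
    fix y assume y: "0 \<le> y" "y \<le> t / 2"
    have "(?f has_real_derivative y * sin y) (at y)"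
      by (auto intro!: derivative_eq_intros)
    moreover have "0 \<le> y * sin y"
      using y assms by (intro mult_nonneg_nonneg sin_ge_zero) auto
    ultimately show "\<exists>d. (?f has_real_derivative d) (at y) \<and> 0 \<le> d" by blast
  qed (use assms in simp)
  then have 1: "t / 2 * cos (t / 2) \<le> sin (t / 2)" by simp
  have "cos (pi / 4) \<le> cos (t / 2)"
    using assms by (intro cos_monotone_0_pi_le) auto
  then have c: "sqrt 2 / 2 \<le> cos (t / 2)" by (simp add: cos_45)
  then have "(sqrt 2 / 2)\<^sup>2 \<le> (cos (t / 2))\<^sup>2"
    by (intro power_mono) auto
  then have c2: "1 / 2 \<le> cos (t / 2) * cos (t / 2)"
    by (simp add: power_divide power2_eq_square)
  have c0: "0 \<le> cos (t / 2)" using c by (smt (verit) divide_nonneg_nonneg real_sqrt_ge_zero)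
  have "t / 2 \<le> t * (cos (t / 2) * cos (t / 2))"
    using mult_left_mono[OF c2 assms(1)] by simp
  also have "\<dots> = 2 * (t / 2 * cos (t / 2)) * cos (t / 2)" by simp
  also have "\<dots> \<le> 2 * sin (t / 2) * cos (t / 2)"
    using 1 c0 by (intro mult_right_mono) auto
  also have "\<dots> = sin t"
    using sin_double[of "t / 2"] by simp
  finally show ?thesis .
qed

text \<open>The mean value inequality for exp between 0 and w, in the disk of radius |w|.\<close>

lemma norm_one_minus_exp_le: "norm (1 - exp w) \<le> norm w * exp (norm w)" for w :: complex
proof -
  have "norm (exp 0 - exp w) \<le> exp (norm w) * norm (0 - w)"
  proof (rule field_differentiable_bound[of "cball 0 (norm w)" exp exp])
    fix z :: complex assume "z \<in> cball 0 (norm w)"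
    then show "norm (exp z) \<le> exp (norm w)"
      using complex_Re_le_cmod[of z] by simp
  qed (auto intro!: derivative_eq_intros)
  then show ?thesis by (simp add: mult.commute)
qed

section \<open>The factors as exponentials of Herglotz integrals\<close>

lemma integrable_indicator_circ_m:
  "A \<in> sets circ_m \<Longrightarrow> integrable circ_m (\<lambda>\<zeta>. c * indicator A \<zeta> :: real)"
  by (auto simp: circ.emeasure_finite less_top[symmetric])

lemma fE_eq: "fE A z = exp (\<i> * herg (\<lambda>\<zeta>. pi * indicator A \<zeta>) z)"
proof -
  have "(LINT \<zeta>:A|circ_m. (\<zeta> + z) / (\<zeta> - z)) = herg (indicator A) z"
    unfolding set_lebesgue_integral_def herg_def hk_def
    by (intro Bochner_Integration.integral_cong) (auto simp: indicator_def)
  then show ?thesis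
    by (simp add: fE_def herg_cmult mult.assoc)
qed

lemma norm_herg_indicator_le:
  assumes A: "A \<in> sets circ_m" and z: "norm z < 1"
  shows "norm (herg (\<lambda>\<zeta>. pi * indicator A \<zeta>) z) \<le> 2 * pi / (1 - norm z) * measure circ_m A"
proof -
  note i = integrable_indicator_circ_m[OF A]
  have "norm (herg (\<lambda>\<zeta>. pi * indicator A \<zeta>) z) \<le> (LINT \<zeta>|circ_m. norm (hk z \<zeta> * of_real (pi * indicator A \<zeta>)))"
    unfolding herg_def by (rule integral_norm_bound)
  also have "\<dots> \<le> (LINT \<zeta>|circ_m. 2 / (1 - norm z) * (pi * indicator A \<zeta>))"
  proof (rule integral_mono_AE)
    show "AE \<zeta> in circ_m. norm (hk z \<zeta> * of_real (pi * indicator A \<zeta>)) \<le> 2 / (1 - norm z) * (pi * indicator A \<zeta>)"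
      using AE_circ_m_sphere
    proof eventually_elim
      case (elim \<zeta>)
      have "\<bar>pi * indicator A \<zeta>\<bar> = pi * indicat_real A \<zeta>" by (simp add: abs_mult)
      then show ?case
        unfolding norm_mult norm_of_real using elim
        by (metis abs_ge_zero mult_right_mono norm_herglotz_kernel_le z)
    qed
    show "integrable circ_m (\<lambda>\<zeta>. norm (hk z \<zeta> * of_real (pi * indicator A \<zeta>)))"
      using herg_integrable[OF i z] by (rule integrable_norm)
  qed (rule integrable_mult_right, rule i)
  also have "\<dots> = 2 * pi / (1 - norm z) * measure circ_m A"
    using A by simp
  finally show ?thesis .
qed

text \<open>On K the Herglotz kernel is bounded by 2 / (1 - R), so the n-th exponent is at most C
  times the measure of E n and the Weierstrass test applies.\<close>

lemma summable_measure_imp_prod_conv: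
  assumes E: "\<And>n. E n \<in> sets circ_m" and sum: "summable (\<lambda>n. measure circ_m (E n))"
  shows "prod_abs_loc_unif (\<lambda>n. fE (E n))"
  unfolding prod_abs_loc_unif_def
proof (intro allI impI)
  fix K :: "complex set" assume K: "compact K \<and> K \<subseteq> ball 0 1"
  obtain R where R: "R < 1" "\<And>z. z \<in> K \<Longrightarrow> norm z \<le> R"
  proof (cases "K = {}")
    case False
    then obtain x where "x \<in> K" "\<And>y. y \<in> K \<Longrightarrow> norm y \<le> norm x"
      using continuous_attains_sup[of K norm] K by (auto intro: continuous_intros)
    then show ?thesis using that[of "norm x"] K by auto
  qed (auto intro: that[of 0])
  define C where "C = 2 * pi / (1 - R)"
  have C: "0 \<le> C" using R by (simp add: C_def)
  have m1: "measure circ_m (E n) \<le> 1" for n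
    using circ.bounded_measure[of "E n"] by simp
  have "uniform_limit K (\<lambda>N z. \<Sum>n<N. norm (1 - fE (E n) z)) (\<lambda>z. \<Sum>n. norm (1 - fE (E n) z)) sequentially"
  proof (rule Weierstrass_m_test)
    show "summable (\<lambda>n. exp C * C * measure circ_m (E n))"
      using sum by (rule summable_mult)
    fix n z assume z: "z \<in> K"
    define w where "w = \<i> * herg (\<lambda>\<zeta>. pi * indicator (E n) \<zeta>) z"
    have nz: "norm z < 1" using R z by fastforce
    have "norm w \<le> 2 * pi / (1 - norm z) * measure circ_m (E n)"
      unfolding w_def norm_mult using norm_herg_indicator_le[OF E nz] by simp
    also have "\<dots> \<le> C * measure circ_m (E n)"
      unfolding C_def using R z by (intro mult_right_mono divide_left_mono) (auto simp: nz)
    finally have w: "norm w \<le> C * measure circ_m (E n)" .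
    also have "\<dots> \<le> C * 1" using m1 C by (intro mult_left_mono) auto
    finally have wC: "norm w \<le> C" by simp
    have "norm (1 - exp w) \<le> norm w * exp (norm w)" by (rule norm_one_minus_exp_le)
    also have "\<dots> \<le> (C * measure circ_m (E n)) * exp C"
      using w wC C by (intro mult_mono) auto
    finally show "norm (norm (1 - fE (E n) z)) \<le> exp C * C * measure circ_m (E n)"
      by (simp add: fE_eq w_def mult_ac)
  qed
  then show "uniformly_convergent_on K (\<lambda>N z. \<Sum>n<N. norm (1 - fE (E n) z))"
    by (rule uniformly_convergentI)
qed

text \<open>The single point z = 0 suffices: for m in [0, 1], |1 - exp (i pi m)| = 2 sin (pi m / 2),
  which is at least pi m / 2 by \<open>sin_ge_half\<close>, hence at least m.\<close>

lemma prod_conv_imp_summable_measure: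
  assumes E: "\<And>n. E n \<in> sets circ_m" and conv: "prod_abs_loc_unif (\<lambda>n. fE (E n))"
  shows "summable (\<lambda>n. measure circ_m (E n))"
proof -
  have "uniformly_convergent_on {0} (\<lambda>N z. \<Sum>n<N. norm (1 - fE (E n) z))"
    using conv unfolding prod_abs_loc_unif_def by auto
  then have "convergent (\<lambda>N. \<Sum>n<N. norm (1 - fE (E n) 0))"
    by (rule uniformly_convergent_imp_convergent) simp
  then have s: "summable (\<lambda>n. norm (1 - fE (E n) 0))"
    by (simp add: summable_iff_convergent)
  have "norm (measure circ_m (E n)) \<le> norm (1 - fE (E n) 0)" for n
  proof -
    define m where "m = measure circ_m (E n)"
    have m: "0 \<le> m" "m \<le> 1"
      using circ.bounded_measure[of "E n"] by (auto simp: m_def)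
    have "herg (\<lambda>\<zeta>. pi * indicator (E n) \<zeta>) 0 = of_real (pi * m)"
      using herg_0[OF integrable_indicator_circ_m[OF E], of pi n] E by (simp add: m_def)
    then have "norm (1 - fE (E n) 0) = norm (exp (\<i> * of_real (pi * m)) - 1)"
      by (simp add: fE_eq norm_minus_commute)
    also have "\<dots> = 2 * \<bar>sin (pi * m / 2)\<bar>" by (rule dist_exp_i_1)
    also have "\<dots> \<ge> 2 * (pi * m / 2 / 2)"
      using m sin_ge_half[of "pi * m / 2"] by simp
    finally have "2 * (pi * m / 2 / 2) \<le> norm (1 - fE (E n) 0)" .
    moreover have "m \<le> pi / 2 * m"
      using mult_right_mono[of 1 "pi / 2" m] pi_gt3 m by simp
    ultimately show ?thesis using m by (simp add: m_def)
  qed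
  then show ?thesis
    by (rule summable_comparison_test'[OF s])
qed

text \<open>Terms that are 0 or pi can tend to 0 only if all but finitely many vanish, so the sum is
  a multiple of pi.\<close>

lemma sin_suminf_pi_indicator:
  assumes "summable (\<lambda>n. pi * indicat_real (E n) x)"
  shows "sin (\<Sum>n. pi * indicat_real (E n) x) = 0"
proof -
  have "(\<lambda>n. pi * indicat_real (E n) x) \<longlonglongrightarrow> 0"
    using assms by (rule summable_LIMSEQ_zero)
  then have "eventually (\<lambda>n. pi * indicat_real (E n) x < pi) sequentially"
    by (rule order_tendstoD) simp
  then obtain N where N: "\<And>n. n \<ge> N \<Longrightarrow> pi * indicat_real (E n) x < pi"
    by (auto simp: eventually_sequentially)
  then have N': "x \<notin> E n" if "n \<ge> N" for n using that by force
  have "(\<Sum>n. pi * indicat_real (E n) x) = (\<Sum>n<N. pi * indicat_real (E n) x)"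
    using N' by (intro suminf_finite) (auto simp: indicator_def not_less)
  also have "\<dots> = (\<Sum>n | n < N \<and> x \<in> E n. pi)"
    by (intro sum.mono_neutral_cong_right) (auto simp: indicator_def)
  also have "\<dots> = real (card {n. n < N \<and> x \<in> E n}) * pi"
    by simp
  finally show ?thesis by (simp only: sin_npi)
qed

text \<open>The exponents are integrated term by term, with majorants proportional to the measures
  of the E n, and add up to \<open>herg v z\<close>; exp turns the sum into the product.\<close>

lemma prodinf_fE_eq:
  assumes E: "\<And>n. E n \<in> sets circ_m" and sum: "summable (\<lambda>n. measure circ_m (E n))"
    and v: "integrable circ_m v" "AE \<zeta> in circ_m. (\<lambda>n. pi * indicat_real (E n) \<zeta>) sums v \<zeta>"
    and z: "norm z < 1"
  shows "(\<Prod>n. fE (E n) z) = exp (\<i> * herg v z)"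
proof -
  define f where "f n \<zeta> = hk z \<zeta> * complex_of_real (pi * indicator (E n) \<zeta>)" for n \<zeta>
  have fi: "integrable circ_m (f n)" for n
    unfolding f_def by (intro herg_integrable integrable_indicator_circ_m E z)
  have fn: "norm (f n \<zeta>) \<le> 2 / (1 - norm z) * (pi * indicator (E n) \<zeta>)" if "norm \<zeta> = 1" for n \<zeta>
  proof -
    have "\<bar>pi * indicator (E n) \<zeta>\<bar> = pi * indicat_real (E n) \<zeta>" by (simp add: abs_mult)
    then show ?thesis
      unfolding f_def norm_mult norm_of_real using that
      by (metis abs_ge_zero mult_right_mono norm_herglotz_kernel_le z)
  qed
  have "(\<lambda>n. LINT \<zeta>|circ_m. f n \<zeta>) sums (LINT \<zeta>|circ_m. (\<Sum>n. f n \<zeta>))"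
  proof (rule sums_integral[OF fi])
    show "AE \<zeta> in circ_m. summable (\<lambda>n. norm (f n \<zeta>))"
      using v(2) AE_circ_m_sphere
    proof eventually_elim
      case (elim \<zeta>)
      have s: "summable (\<lambda>n. 2 / (1 - norm z) * (pi * indicat_real (E n) \<zeta>))"
        by (rule summable_mult) (rule sums_summable[OF elim(1)])
      show ?case
        by (rule summable_comparison_test'[OF s, of 0]) (use fn[OF elim(2)] in auto)
    qed
    have s: "summable (\<lambda>n. 2 / (1 - norm z) * (pi * measure circ_m (E n)))"
      by (intro summable_mult sum)
    show "summable (\<lambda>n. LINT \<zeta>|circ_m. norm (f n \<zeta>))"
    proof (rule summable_comparison_test'[OF s, of 0])
      fix n :: nat
      have "(LINT \<zeta>|circ_m. norm (f n \<zeta>)) \<le> (LINT \<zeta>|circ_m. 2 / (1 - norm z) * (pi * indicator (E n) \<zeta>))"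
        using fn fi integrable_indicator_circ_m[OF E, of pi n] AE_circ_m_sphere
        by (intro integral_mono_AE integrable_norm integrable_mult_right) (auto elim: eventually_mono)
      also have "\<dots> = 2 / (1 - norm z) * (pi * measure circ_m (E n))"
        using E by simp
      finally show "norm (LINT \<zeta>|circ_m. norm (f n \<zeta>)) \<le> 2 / (1 - norm z) * (pi * measure circ_m (E n))" by simp
    qed
  qed
  also have "(\<lambda>n. LINT \<zeta>|circ_m. f n \<zeta>) = (\<lambda>n. herg (\<lambda>\<zeta>. pi * indicator (E n) \<zeta>) z)"
    by (simp add: herg_def f_def[abs_def])
  also have "(LINT \<zeta>|circ_m. (\<Sum>n. f n \<zeta>)) = herg v z"
    unfolding herg_def
  proof (rule integral_cong_AE)
    show "AE \<zeta> in circ_m. (\<Sum>n. f n \<zeta>) = hk z \<zeta> * of_real (v \<zeta>)"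
      using v(2)
    proof eventually_elim
      case (elim \<zeta>)
      have "(\<lambda>n. f n \<zeta>) sums (hk z \<zeta> * of_real (v \<zeta>))"
        unfolding f_def by (intro sums_mult sums_of_real elim)
      then show ?case by (simp add: sums_iff)
    qed
    show "(\<lambda>\<zeta>. \<Sum>n. f n \<zeta>) \<in> borel_measurable circ_m"
      using fi by (intro borel_measurable_suminf) auto
    show "(\<lambda>\<zeta>. hk z \<zeta> * of_real (v \<zeta>)) \<in> borel_measurable circ_m"
      using herg_integrable[OF v(1) z] by simp
  qed
  finally have "(\<lambda>n. \<i> * herg (\<lambda>\<zeta>. pi * indicator (E n) \<zeta>) z) sums (\<i> * herg v z)"
    by (rule sums_mult)
  \<comment> \<open>The limit is an exponential and hence nonzero, which is the first disjunct of
    \<open>has_prod_def\<close>, with no initial factors split off.\<close>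
  then have "(\<lambda>n. fE (E n) z) has_prod exp (\<i> * herg v z)"
    unfolding fE_eq has_prod_def by (intro disjI1 sums_imp_has_prod_exp)
  then show ?thesis by (simp add: has_prod_iff)
qed

text \<open>The series v is \<open>ennreal\<close>-valued so that (b) makes sense before convergence
  is known. Under (c) it is finite almost everywhere, so \<open>enn2real\<close>, which sends
  infinity to 0, changes it only on a null set.\<close>

theorem theorem4p5:
  fixes E :: "nat \<Rightarrow> complex set"
  assumes meas: "\<And>n. circ_measurable (E n)"
  defines "v \<equiv> (\<lambda>\<zeta>. \<Sum>n. ennreal (pi * indicator (E n) \<zeta>))"
  shows "(summable (\<lambda>n. measure circ_m (E n)) \<longleftrightarrow> (\<integral>\<^sup>+ \<zeta>. v \<zeta> \<partial>circ_m) < \<infinity>)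
       \<and> ((\<integral>\<^sup>+ \<zeta>. v \<zeta> \<partial>circ_m) < \<infinity> \<longleftrightarrow> prod_abs_loc_unif (\<lambda>n. fE (E n)))
       \<and> (prod_abs_loc_unif (\<lambda>n. fE (E n)) \<longrightarrow>
            (Rplus (\<lambda>z. \<Prod>n. fE (E n) z) \<longleftrightarrow> LlogL (\<lambda>\<zeta>. enn2real (v \<zeta>))))"
proof -
  have E[measurable]: "E n \<in> sets circ_m" for n
    using meas by (simp add: circ_measurable_def)
  have vm[measurable]: "v \<in> borel_measurable circ_m"
    unfolding v_def by measurable
  have "(\<integral>\<^sup>+ \<zeta>. v \<zeta> \<partial>circ_m) = (\<Sum>n. \<integral>\<^sup>+ \<zeta>. ennreal (pi * indicator (E n) \<zeta>) \<partial>circ_m)"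
    unfolding v_def by (rule nn_integral_suminf) measurable
  also have "\<dots> = (\<Sum>n. ennreal (pi * measure circ_m (E n)))"
  proof (rule suminf_cong)
    fix n
    have "(\<integral>\<^sup>+ \<zeta>. ennreal (pi * indicator (E n) \<zeta>) \<partial>circ_m) = ennreal (LINT \<zeta>|circ_m. pi * indicator (E n) \<zeta>)"
      by (intro nn_integral_eq_integral integrable_indicator_circ_m E) auto
    then show "(\<integral>\<^sup>+ \<zeta>. ennreal (pi * indicator (E n) \<zeta>) \<partial>circ_m) = ennreal (pi * measure circ_m (E n))"
      by simp
  qed
  finally have vint: "(\<integral>\<^sup>+ \<zeta>. v \<zeta> \<partial>circ_m) = (\<Sum>n. ennreal (pi * measure circ_m (E n)))" .
  have ab: "summable (\<lambda>n. measure circ_m (E n)) \<longleftrightarrow> (\<integral>\<^sup>+ \<zeta>. v \<zeta> \<partial>circ_m) < \<infinity>"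
  proof
    assume "summable (\<lambda>n. measure circ_m (E n))"
    then have "summable (\<lambda>n. pi * measure circ_m (E n))" by (rule summable_mult)
    then show "(\<integral>\<^sup>+ \<zeta>. v \<zeta> \<partial>circ_m) < \<infinity>"
      unfolding vint by (subst suminf_ennreal2) auto
  next
    assume "(\<integral>\<^sup>+ \<zeta>. v \<zeta> \<partial>circ_m) < \<infinity>"
    then have "summable (\<lambda>n. pi * measure circ_m (E n))"
      unfolding vint by (intro summable_suminf_not_top) auto
    then show "summable (\<lambda>n. measure circ_m (E n))"
      by (simp add: summable_mult_D)
  qed
  have ac: "summable (\<lambda>n. measure circ_m (E n)) \<longleftrightarrow> prod_abs_loc_unif (\<lambda>n. fE (E n))"
    using summable_measure_imp_prod_conv[of E] prod_conv_imp_summable_measure[of E] E by blast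
  have "Rplus (\<lambda>z. \<Prod>n. fE (E n) z) \<longleftrightarrow> LlogL (\<lambda>\<zeta>. enn2real (v \<zeta>))" if "prod_abs_loc_unif (\<lambda>n. fE (E n))"
  proof -
    have sum: "summable (\<lambda>n. measure circ_m (E n))" using ac that by simp
    then have fin: "(\<integral>\<^sup>+ \<zeta>. v \<zeta> \<partial>circ_m) < \<infinity>" using ab by simp
    then have top: "AE \<zeta> in circ_m. v \<zeta> \<noteq> \<infinity>"
      by (intro nn_integral_PInf_AE) auto
    have sums: "AE \<zeta> in circ_m. (\<lambda>n. pi * indicat_real (E n) \<zeta>) sums enn2real (v \<zeta>)"
      using top
    proof eventually_elim
      case (elim \<zeta>)
      then have s: "summable (\<lambda>n. pi * indicat_real (E n) \<zeta>)"
        unfolding v_def by (intro summable_suminf_not_top) auto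
      then have "v \<zeta> = ennreal (\<Sum>n. pi * indicat_real (E n) \<zeta>)"
        unfolding v_def by (intro suminf_ennreal2) auto
      then have "enn2real (v \<zeta>) = (\<Sum>n. pi * indicat_real (E n) \<zeta>)"
        using s by (simp add: suminf_nonneg)
      then show ?case using s by (simp add: summable_sums)
    qed
    have vi: "integrable circ_m (\<lambda>\<zeta>. enn2real (v \<zeta>))"
    proof (rule integrableI_bounded)
      have "(\<integral>\<^sup>+ \<zeta>. ennreal (norm (enn2real (v \<zeta>))) \<partial>circ_m) \<le> (\<integral>\<^sup>+ \<zeta>. v \<zeta> \<partial>circ_m)"
        by (intro nn_integral_mono) (auto simp: ennreal_enn2real_if)
      then show "(\<integral>\<^sup>+ \<zeta>. ennreal (norm (enn2real (v \<zeta>))) \<partial>circ_m) < \<infinity>"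
        using fin by simp
    qed measurable
    have sin: "AE \<zeta> in circ_m. sin (enn2real (v \<zeta>)) = 0"
      using sums
    proof eventually_elim
      case (elim \<zeta>)
      then show ?case
        using sin_suminf_pi_indicator[of E \<zeta>] by (simp add: sums_iff)
    qed
    show ?thesis
      by (rule Rplus_exp_herg_iff[OF vi _ sin])
         (auto intro!: prodinf_fE_eq E sum vi sums)
  qed
  with ab ac show ?thesis by blast
qed

end
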